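(* For every $s\in\mathbb{C}$, \[ s(s-1)\frac{\zeta(s)\Gamma(\frac{s}{2})}{\pi^{s/2}}=1-s(1-s)\sum_{k=1}^{\infty}\left(\frac{\Gamma(\frac{s}{2},k^{2}\pi)}{(k^{2}\pi)^{s/2}}+\frac{\Gamma(\frac{1-s}{2},k^{2}\pi)}{(k^{2}\pi)^{(1-s)/2}}\right). \] More generally, for every $x\in\mathbb{C}$ with $\Re(x)>|\Im(x)|$, \[ s(s-1)\frac{\zeta(s)\Gamma(\frac{s}{2})}{\pi^{s/2}}=(1-s)x^{s}+s\,x^{s-1}+s(s-1)\sum_{k=1}^{\infty}\left(\frac{\Gamma(\frac{s}{2},k^{2}x^{2}\pi)}{(k^{2}\pi)^{s/2}}+\frac{\Gamma(\frac{1-s}{2},\frac{k^{2}\pi}{x^{2}})}{(k^{2}\pi)^{(1-s)/2}}\right); \] moreover, for such $x$, \[ (2^{s}-1)(1-2^{1-s})\frac{\zeta(s)\Gamma(\frac{s}{2})}{\pi^{s/2}}=\Upsilon_{x}(s)+\Upsilon_{1/x}(1-s), \] where \[ \Upsilon_{x}(s)=\sum_{k=0}^{\infty}\left(\frac{\Gamma\!\left(\frac{s}{2},\frac{(4k+1)^{2}\pi x^{2}}{4}\right)}{\left(\frac{(4k+1)^{2}\pi}{4}\right)^{s/2}}-2\frac{\Gamma\!\left(\frac{s}{2},\frac{(4k+2)^{2}\pi x^{2}}{4}\right)}{\left(\frac{(4k+2)^{2}\pi}{4}\right)^{s/2}}+\frac{\Gamma\!\left(\frac{s}{2},\frac{(4k+3)^{2}\pi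 x^{2}}{4}\right)}{\left(\frac{(4k+3)^{2}\pi}{4}\right)^{s/2}}\right). \]
   Context: $\zeta$ is the Riemann zeta function and $\Gamma$ the Gamma function; the left-hand sides are understood as their analytic (entire) continuations in $s$. $\Gamma(s,z):=\int_{z}^{\infty}t^{s-1}e^{-t}\,dt$ is the upper incomplete Gamma function. Powers are principal branches. *)

theory Defs
  imports "HOL-Complex_Analysis.Complex_Analysis"
begin

text \<open>
  The Riemann zeta function as the unique analytic continuation of the Dirichlet series to the
  punctured plane. The value at the pole is fixed to \<open>0\<close> only to make the description unique.
\<close>
definition zeta :: "complex \<Rightarrow> complex" where
  "zeta = (THE f. f holomorphic_on (- {1}) \<and>
                  (\<forall>s. Re s > 1 \<longrightarrow> f s = (\<Sum>n. 1 / of_nat (Suc n) powr s)) \<and>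
                  f 1 = 0)"

text \<open>
  The integral from \<open>z\<close> to infinity is taken along the horizontal ray \<open>z + t\<close>, \<open>t \<ge> 0\<close>. For \<open>z\<close> off
  the nonpositive real axis this ray avoids the branch cut of the principal power.
\<close>
definition Gamma_upper :: "complex \<Rightarrow> complex \<Rightarrow> complex" where
  "Gamma_upper s z =
     integral {0..} (\<lambda>t::real. (z + of_real t) powr (s - 1) * exp (- (z + of_real t)))"

definition Upsilon_summand :: "complex \<Rightarrow> complex \<Rightarrow> nat \<Rightarrow> complex" where
  "Upsilon_summand x s k =
     (let q = (\<lambda>j. of_nat (4 * k + j) ^ 2 * of_real pi / 4 :: complex);
          g = (\<lambda>j. Gamma_upper (s / 2) (q j * x ^ 2) / q j powr (s / 2))
      in g 1 - 2 * g 2 + g 3)"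

definition Upsilon :: "complex \<Rightarrow> complex \<Rightarrow> complex" where
  "Upsilon x s = (\<Sum>k. Upsilon_summand x s k)"

text \<open>
  The summand of index \<open>k + 1\<close> of the series for the completed zeta function, split at \<open>x\<close>.
\<close>
definition xi_summand :: "complex \<Rightarrow> complex \<Rightarrow> nat \<Rightarrow> complex" where
  "xi_summand x s k =
     (let p = of_nat (Suc k) ^ 2 * of_real pi :: complex
      in Gamma_upper (s / 2) (p * x ^ 2) / p powr (s / 2)
         + Gamma_upper ((1 - s) / 2) (p / x ^ 2) / p powr ((1 - s) / 2))"

text \<open>
  \<open>F\<close> is the entire continuation of \<open>f\<close>, where \<open>f\<close> is given by a formula in \<open>zeta s\<close> and
  \<open>Gamma (s / 2)\<close> and is therefore meaningful away from the poles of these two factors.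
\<close>
definition entire_continuation :: "(complex \<Rightarrow> complex) \<Rightarrow> (complex \<Rightarrow> complex) \<Rightarrow> bool" where
  "entire_continuation f F \<longleftrightarrow>
     F holomorphic_on UNIV \<and> (\<forall>s. s \<noteq> 1 \<and> s / 2 \<notin> \<int>\<^sub>\<le>\<^sub>0 \<longrightarrow> F s = f s)"

end

theory Submission
  imports Defs "HOL-Probability.Probability" "HOL-Real_Asymp.Real_Asymp"
begin

text \<open>
  Write \<open>A x s\<close> for the sum over \<open>n \<ge> 1\<close> of \<open>Gamma_upper (s / 2) (n\<^sup>2 * pi * x\<^sup>2) / (n\<^sup>2 * pi) powr (s / 2)\<close> and
  \<open>H x s = (1 - s) * x powr s + s * x powr (s - 1) + s * (s - 1) * (A x s + A (1 / x) (1 - s))\<close>.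
  The \<open>x\<close>-derivative of \<open>A\<close> is \<open>- 2 * x powr (s - 1)\<close> times the half theta series at \<open>x\<^sup>2\<close>, so for
  real \<open>x\<close> the theta functional equation says exactly that \<open>H\<close> has derivative 0 in \<open>x\<close>; by analytic
  continuation \<open>H\<close> does not depend on \<open>x\<close> in the sector \<open>Re x > \<bar>Im x\<bar>\<close>. For \<open>Re s > 1\<close> letting \<open>x\<close> tend
  to 0 gives \<open>s * (s - 1) * pi powr (- s / 2) * Gamma (s / 2)\<close> times the Dirichlet series, so \<open>H 1\<close> is the
  entire continuation, and dividing out the Gamma factor shows that the function described by
  \<open>zeta\<close> exists. \<open>Upsilon x s\<close> is \<open>2 powr s * A (x / 2) s - 3 * A x s + 2 * 2 powr (- s) * A (2 * x) s\<close>; in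
  \<open>Upsilon x s + Upsilon (1 / x) (1 - s)\<close> the elementary terms of \<open>H\<close> cancel.
\<close>

section \<open>The upper incomplete Gamma function\<close>

text \<open>The sector consists of the points of the right half-plane whose squares have positive
  real part, which is what convergence at \<open>n\<^sup>2 * pi * x\<^sup>2\<close> asks for.
  Estimates are made uniform on truncated cones \<open>Re z \<ge> \<delta>\<close>,
  \<open>cmod z \<le> K * Re z\<close>: these are stable under horizontal translation to the right
  and under scaling by factors at least 1, and every compact subset of the open right half-plane
  lies in one. The theta equation is Poisson summation for a Gaussian. Its periodization is entire,
  so the convergence of the Fourier series at the single point 0 can be had by elementary means. The
  elementary terms of \<open>H\<close> have derivative
  \<open>s * (s - 1) * (x powr (s - 2) - x powr (s - 1))\<close>; they supply the summand 1 on the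
  two sides of the theta equation. The factor \<open>s * (s - 1)\<close> makes \<open>H\<close> free
  of poles, but the identity for \<open>Upsilon\<close> does not contain it: there it must be
  cancelled, and the points 0 and 1 need an extra continuation argument.\<close>

lemma norm_powr_le_exp:
  fixes R K \<delta> \<epsilon> :: real
  assumes "\<delta> > 0" "\<epsilon> > 0"
  obtains C where "C > 0"
    "\<And>b w. \<lbrakk>cmod b \<le> R; Re w \<ge> \<delta>; cmod w \<le> K * Re w\<rbrakk> \<Longrightarrow> cmod (w powr b) \<le> C * exp (\<epsilon> * Re w)"
proof -
  define r where "r = max R 1"
  define k where "k = max K 1"
  have r: "r \<ge> 1" "r \<ge> R" and k: "k \<ge> 1" "k \<ge> K"
    by (auto simp: r_def k_def)
  \<comment> \<open>The logarithm grows more slowly than any linear function: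
    \<open>ln (c * cmod w) \<le> c * cmod w\<close>. The value of \<open>c\<close> pays for the
    factor \<open>r\<close> from the exponent and the factor \<open>k\<close> from the cone, so that
    \<open>r * c * cmod w \<le> \<epsilon> * Re w\<close>.\<close>
  define c where "c = \<epsilon> / (r * k)"
  have c: "c > 0" using assms r k by (simp add: c_def)
  define C where "C = exp (r * (\<bar>ln c\<bar> + \<bar>ln \<delta>\<bar>) + r * pi)"
  have "cmod (w powr b) \<le> C * exp (\<epsilon> * Re w)"
    if b: "cmod b \<le> R" and w: "Re w \<ge> \<delta>" "cmod w \<le> K * Re w" for b w
  proof -
    have w0: "w \<noteq> 0" using w assms by auto
    have pos: "cmod w \<ge> \<delta>" using w complex_Re_le_cmod[of w] by linarith
    have "\<bar>Re b\<bar> \<le> r" "\<bar>Im b\<bar> \<le> r"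
      using abs_Re_le_cmod[of b] abs_Im_le_cmod[of b] b r by linarith+
    have cw: "c * cmod w > 0" using c w0 by simp
    have l1: "ln (cmod w) \<le> c * cmod w + \<bar>ln c\<bar>"
    proof -
      have "ln (c * cmod w) \<le> c * cmod w" using ln_bound[OF cw] by simp
      moreover have "ln (c * cmod w) = ln c + ln (cmod w)"
        using c w0 by (simp add: ln_mult)
      ultimately show ?thesis by linarith
    qed
    have l2: "ln (cmod w) \<ge> ln \<delta>"
      using pos assms by (subst ln_le_cancel_iff) auto
    have l3: "\<bar>ln (cmod w)\<bar> \<le> c * cmod w + (\<bar>ln c\<bar> + \<bar>ln \<delta>\<bar>)"
      using l1 l2 cw by linarith
    have "Re (b * Ln w) = Re b * ln (cmod w) - Im b * Im (Ln w)" using w0 by simp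
    also have "\<dots> \<le> \<bar>Re b * ln (cmod w)\<bar> + \<bar>Im b * Im (Ln w)\<bar>" by linarith
    also have "\<dots> \<le> r * (c * cmod w + (\<bar>ln c\<bar> + \<bar>ln \<delta>\<bar>)) + r * pi"
      unfolding abs_mult using \<open>\<bar>Re b\<bar> \<le> r\<close> \<open>\<bar>Im b\<bar> \<le> r\<close> l3 r
        Im_Ln_le_pi[OF w0] mpi_less_Im_Ln[OF w0]
      by (intro add_mono mult_mono) auto
    also have "\<dots> = r * c * cmod w + (r * (\<bar>ln c\<bar> + \<bar>ln \<delta>\<bar>) + r * pi)"
      by (simp add: algebra_simps)
    also have "r * c * cmod w \<le> \<epsilon> * Re w"
    proof -
      have "r * c = \<epsilon> / k" using r by (simp add: c_def)
      have "K * Re w \<le> k * Re w" using k w assms by (intro mult_right_mono) auto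
      then have "cmod w \<le> k * Re w" using w by linarith
      then show ?thesis unfolding \<open>r * c = \<epsilon> / k\<close>
        using k assms by (simp add: field_simps mult_left_mono)
    qed
    finally have "Re (b * Ln w) \<le> \<epsilon> * Re w + (r * (\<bar>ln c\<bar> + \<bar>ln \<delta>\<bar>) + r * pi)" by simp
    then have "exp (Re (b * Ln w)) \<le> C * exp (\<epsilon> * Re w)"
      unfolding C_def exp_add[symmetric] by simp
    then show ?thesis using w0 by (simp add: powr_def)
  qed
  moreover have "C > 0" by (simp add: C_def)
  ultimately show ?thesis using that by blast
qed

text \<open>Half of the decay of \<open>exp (- w)\<close> is spent on absorbing the power, so that
  one constant serves all exponents in a disc.\<close>

lemma norm_Gamma_upper_integrand_le:
  fixes R K \<delta> :: real
  assumes "\<delta> > 0"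
  obtains C where "C > 0"
    "\<And>a w. \<lbrakk>cmod a \<le> R; Re w \<ge> \<delta>; cmod w \<le> K * Re w\<rbrakk> \<Longrightarrow>
       cmod (w powr (a - 1) * exp (- w)) \<le> C * exp (- Re w / 2)"
proof -
  obtain C where C: "C > 0"
    "\<And>b w. \<lbrakk>cmod b \<le> R + 1; Re w \<ge> \<delta>; cmod w \<le> K * Re w\<rbrakk> \<Longrightarrow> cmod (w powr b) \<le> C * exp (1/2 * Re w)"
    using norm_powr_le_exp[OF assms, of "1/2" "R+1" K] by auto
  have "cmod (w powr (a - 1) * exp (- w)) \<le> C * exp (- Re w / 2)"
    if "cmod a \<le> R" "Re w \<ge> \<delta>" "cmod w \<le> K * Re w" for a w
  proof -
    have "cmod (a - 1) \<le> R + 1" using norm_triangle_ineq4[of a 1] that by simp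
    then have "cmod (w powr (a - 1)) \<le> C * exp (1/2 * Re w)" using C that by blast
    then have "cmod (w powr (a - 1)) * exp (- Re w) \<le> C * exp (1/2 * Re w) * exp (- Re w)"
      by (intro mult_right_mono) auto
    also have "\<dots> = C * exp (- Re w / 2)"
      by (simp add: exp_add[symmetric])
    finally show ?thesis by (simp add: norm_mult)
  qed
  then show ?thesis using that C(1) by blast
qed

text \<open>Since \<open>K \<ge> 1\<close>, the horizontal ray from a point of the cone stays in the
  cone, and the pointwise bound can be integrated along it. Integrability is carried along because
  \<open>integral\<close> has the default value 0 on functions that are not integrable.\<close>

lemma Gamma_upper_bound:
  fixes R K \<delta> :: real
  assumes "\<delta> > 0" "K \<ge> 1"
  obtains C where "C > 0"
    "\<And>a z. \<lbrakk>cmod a \<le> R; Re z \<ge> \<delta>; cmod z \<le> K * Re z\<rbrakk> \<Longrightarrow>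
       (\<lambda>t. (z + of_real t) powr (a - 1) * exp (- (z + of_real t))) absolutely_integrable_on {0::real..} \<and>
       cmod (Gamma_upper a z) \<le> C * exp (- Re z / 2)"
proof -
  obtain C where C: "C > 0"
    "\<And>a w. \<lbrakk>cmod a \<le> R; Re w \<ge> \<delta>; cmod w \<le> K * Re w\<rbrakk> \<Longrightarrow>
       cmod (w powr (a - 1) * exp (- w)) \<le> C * exp (- Re w / 2)"
    using norm_Gamma_upper_integrand_le[OF assms(1), of R K] by auto
  have "(\<lambda>t. (z + of_real t) powr (a - 1) * exp (- (z + of_real t))) absolutely_integrable_on {0::real..} \<and>
       cmod (Gamma_upper a z) \<le> (2 * C) * exp (- Re z / 2)"
    if a: "cmod a \<le> R" and z: "Re z \<ge> \<delta>" "cmod z \<le> K * Re z" for a z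
  proof -
    define f where "f = (\<lambda>t::real. (z + of_real t) powr (a - 1) * exp (- (z + of_real t)))"
    define g where "g = (\<lambda>t::real. C * exp (- Re z / 2) * exp (- (1/2) * t))"
    have le: "cmod (f t) \<le> g t" if "t \<ge> 0" for t
    proof -
      have "cmod (z + of_real t) \<le> cmod z + t" using norm_triangle_ineq[of z "of_real t"] that by simp
      also have "\<dots> \<le> K * Re z + K * t"
        using z(2) mult_right_mono[OF assms(2) that] by linarith
      finally have 1: "cmod (z + of_real t) \<le> K * Re (z + of_real t)" by (simp add: algebra_simps)
      have "cmod (f t) \<le> C * exp (- Re (z + of_real t) / 2)"
        unfolding f_def by (rule C(2)[OF a _ 1]) (use z that in auto)
      also have "\<dots> = g t" by (simp add: g_def exp_add[symmetric] field_simps)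
      finally show ?thesis .
    qed
    have "((\<lambda>t::real. exp (- (1/2) * t)) has_integral exp (- (1/2) * 0) / (1/2)) {0..}"
      by (rule has_integral_exp_minus_to_infinity) simp
    from has_integral_mult_right[OF this, of "C * exp (- Re z / 2)"]
    have g: "(g has_integral (2 * C) * exp (- Re z / 2)) {0..}"
      unfolding g_def by (simp add: mult_ac)
    have cont: "continuous_on {0..} f"
      unfolding f_def using z assms
      by (intro continuous_intros) (auto simp: complex_eq_iff complex_nonpos_Reals_iff)
    have meas: "f \<in> borel_measurable (lebesgue_on {0..})"
      by (rule continuous_imp_measurable_on_sets_lebesgue[OF cont]) auto
    have ai: "f absolutely_integrable_on {0..}"
      by (rule measurable_bounded_by_integrable_imp_absolutely_integrable[OF meas _ has_integral_integrable[OF g]])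
         (use le in auto)
    have "cmod (integral {0..} f) \<le> integral {0..} g"
      by (rule integral_norm_bound_integral[OF set_lebesgue_integral_eq_integral(1)[OF ai] has_integral_integrable[OF g]])
         (use le in auto)
    also have "integral {0..} g = (2 * C) * exp (- Re z / 2)" using g by (rule integral_unique)
    finally show ?thesis using ai unfolding Gamma_upper_def f_def by simp
  qed
  moreover have "2 * C > 0" using C by simp
  ultimately show ?thesis using that by blast
qed

lemma Gamma_upper_integrable:
  assumes "Re z > 0"
  shows "(\<lambda>t. (z + of_real t) powr (a - 1) * exp (- (z + of_real t))) absolutely_integrable_on {0::real..}"
proof -
  have "cmod z \<le> (max 1 (cmod z / Re z)) * Re z"
    using assms by (simp add: max_mult_distrib_right)
  moreover obtain C where "\<And>b w. \<lbrakk>cmod b \<le> cmod a; Re w \<ge> Re z; cmod w \<le> max 1 (cmod z / Re z) * Re w\<rbrakk> \<Longrightarrow>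
       (\<lambda>t. (w + of_real t) powr (b - 1) * exp (- (w + of_real t))) absolutely_integrable_on {0::real..}"
    by (rule Gamma_upper_bound[OF assms, of "max 1 (cmod z / Re z)" "cmod a"]) auto
  ultimately show ?thesis by blast
qed

text \<open>Translation of the integration variable. Only the starting point \<open>z + n\<close>
  has to lie in the right half-plane; the case \<open>z = 0\<close> later identifies the ray
  integral with a tail of Euler's integral.\<close>

lemma Gamma_upper_shift:
  assumes "Re z + n > 0"
  shows "(\<lambda>t. (z + of_real t) powr (a - 1) * exp (- (z + of_real t))) absolutely_integrable_on {n..}"
    and "integral {n..} (\<lambda>t. (z + of_real t) powr (a - 1) * exp (- (z + of_real t))) = Gamma_upper a (z + of_real n)"
proof -
  define f where "f = (\<lambda>t::real. (z + of_real t) powr (a - 1) * exp (- (z + of_real t)))"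
  have shift: "(\<lambda>t. \<bar>1\<bar> *\<^sub>R f (n + t)) = (\<lambda>t. ((z + of_real n) + of_real t) powr (a - 1) * exp (- ((z + of_real n) + of_real t)))"
    by (simp add: f_def fun_eq_iff algebra_simps)
  have img: "(+) n ` {0..} = {n..}" by simp
  have "f absolutely_integrable_on ((+) n ` {0..}) \<and> integral ((+) n ` {0..}) f = Gamma_upper a (z + of_real n)"
  proof (subst has_absolute_integral_change_of_variables_real[symmetric, where h = "\<lambda>_. 1"])
    show "((+) n has_field_derivative 1) (at x within {0..})" for x :: real
      by (auto intro!: derivative_eq_intros)
    show "(\<lambda>t. \<bar>1\<bar> *\<^sub>R f (n + t)) absolutely_integrable_on {0..} \<and>
        integral {0..} (\<lambda>t. \<bar>1\<bar> *\<^sub>R f (n + t)) = Gamma_upper a (z + of_real n)"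
      unfolding shift using Gamma_upper_integrable[of "z + of_real n" a] assms
      by (simp add: Gamma_upper_def)
  qed auto
  then show "(\<lambda>t. (z + of_real t) powr (a - 1) * exp (- (z + of_real t))) absolutely_integrable_on {n..}"
    and "integral {n..} (\<lambda>t. (z + of_real t) powr (a - 1) * exp (- (z + of_real t))) = Gamma_upper a (z + of_real n)"
    unfolding img f_def by auto
qed

lemma Gamma_upper_split:
  assumes "Re z > 0" "n \<ge> 0"
  shows "Gamma_upper a z =
    integral {0..n} (\<lambda>t. (z + of_real t) powr (a - 1) * exp (- (z + of_real t))) + Gamma_upper a (z + of_real n)"
proof -
  define f where "f = (\<lambda>t::real. (z + of_real t) powr (a - 1) * exp (- (z + of_real t)))"
  have int: "f integrable_on {0..}"
    unfolding f_def by (rule set_lebesgue_integral_eq_integral(1)[OF Gamma_upper_integrable[OF assms(1)]])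
  have int1: "f integrable_on {0..n}"
    using integrable_on_subinterval[OF int, of 0 n] by auto
  have int2: "f integrable_on {n..}"
    unfolding f_def by (rule set_lebesgue_integral_eq_integral(1)[OF Gamma_upper_shift(1)]) (use assms in auto)
  have un: "{0..} = {0..n} \<union> {n..}" using assms by auto
  have "{0..n} \<inter> {n..} \<subseteq> {n}" by auto
  then have "negligible ({0..n} \<inter> {n..})" using negligible_subset negligible_sing by blast
  then have "integral {0..} f = integral {0..n} f + integral {n..} f"
    unfolding un using int1 int2 by (intro Henstock_Kurzweil_Integration.integral_Un) auto
  then show ?thesis
    using Gamma_upper_shift(2)[of z n a] assms unfolding Gamma_upper_def f_def by simp
qed

section \<open>Uniform tail estimates, holomorphy in the parameter and the derivative in the lower
  limit\<close>

lemma Re_pos_compact_bounds: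
  assumes "compact S" "\<And>z. z \<in> S \<Longrightarrow> Re z > 0"
  obtains \<delta> K where "\<delta> > 0" "K \<ge> 1" "\<And>z. z \<in> S \<Longrightarrow> Re z \<ge> \<delta> \<and> cmod z \<le> K * Re z"
proof (cases "S = {}")
  case True
  then show ?thesis using that[of 1 1] by auto
next
  case False
  obtain z0 where z0: "z0 \<in> S" "\<And>z. z \<in> S \<Longrightarrow> Re z0 \<le> Re z"
    using continuous_attains_inf[OF assms(1) False, of Re] continuous_on_Re[OF continuous_on_id] by blast
  obtain M where M: "\<And>z. z \<in> S \<Longrightarrow> cmod z \<le> M"
    using compact_imp_bounded[OF assms(1)] by (auto simp: bounded_iff)
  define K where "K = max 1 (M / Re z0)"
  have pos: "Re z0 > 0" using assms z0 by auto
  have "cmod z \<le> K * Re z" if "z \<in> S" for z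
  proof -
    have "M \<ge> 0" using M[OF that] norm_ge_zero[of z] by linarith
    have "cmod z \<le> M" using M that by auto
    also have "\<dots> = (M / Re z0) * Re z0" using pos by simp
    also have "\<dots> \<le> K * Re z"
      using z0(2)[OF that] pos \<open>M \<ge> 0\<close> by (intro mult_mono) (auto simp: K_def)
    finally show ?thesis .
  qed
  then show ?thesis using that[of "Re z0" K] pos z0 by (auto simp: K_def)
qed

text \<open>This is the error of truncating the integral at \<open>n\<close>, uniform in the
  parameter and in the starting point; it drives both limits of holomorphic functions below.\<close>

lemma Gamma_upper_shift_uniform:
  fixes R K \<delta> :: real
  assumes "\<delta> > 0" "K \<ge> 1"
  obtains C where "\<And>a z n. \<lbrakk>cmod a \<le> R; Re z \<ge> \<delta>; cmod z \<le> K * Re z\<rbrakk> \<Longrightarrow>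
       cmod (Gamma_upper a (z + of_nat n)) \<le> C * exp (- real n / 2)"
proof -
  obtain C where C: "C > 0" "\<And>a z. \<lbrakk>cmod a \<le> R; Re z \<ge> \<delta>; cmod z \<le> K * Re z\<rbrakk> \<Longrightarrow>
       cmod (Gamma_upper a z) \<le> C * exp (- Re z / 2)"
    by (rule Gamma_upper_bound[OF assms, of R]) blast
  have "cmod (Gamma_upper a (z + of_nat n)) \<le> C * exp (- real n / 2)"
    if "cmod a \<le> R" "Re z \<ge> \<delta>" "cmod z \<le> K * Re z" for a z n
  proof -
    have "cmod (z + of_nat n) \<le> cmod z + real n" using norm_triangle_ineq[of z "of_nat n"] by simp
    also have "\<dots> \<le> K * Re z + K * real n"
      using that(3) mult_right_mono[OF assms(2), of "real n"] by simp
    finally have "cmod (z + of_nat n) \<le> K * Re (z + of_nat n)" by (simp add: algebra_simps)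
    then have "cmod (Gamma_upper a (z + of_nat n)) \<le> C * exp (- Re (z + of_nat n) / 2)"
      using that by (intro C) auto
    also have "\<dots> \<le> C * exp (- real n / 2)"
      using C that assms by (intro mult_left_mono) auto
    finally show ?thesis .
  qed
  then show ?thesis using that by blast
qed

lemma uniform_limit_norm_le:
  fixes f :: "nat \<Rightarrow> 'a \<Rightarrow> 'b::real_normed_vector"
  assumes "\<And>n x. x \<in> S \<Longrightarrow> norm (f n x - l x) \<le> h n" "h \<longlonglongrightarrow> 0"
  shows "uniform_limit S f l sequentially"
proof (rule uniform_limitI)
  fix e :: real assume "e > 0"
  then have "\<forall>\<^sub>F n in sequentially. h n < e" using order_tendstoD(2)[OF assms(2)] by auto
  then show "\<forall>\<^sub>F n in sequentially. \<forall>x\<in>S. dist (f n x) (l x) < e"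
    by eventually_elim (use assms(1) in \<open>auto simp: dist_norm intro: le_less_trans\<close>)
qed

lemma tendsto_exp_neg_half: "(\<lambda>n. C * exp (- real n / 2)) \<longlonglongrightarrow> 0"
  by real_asymp

text \<open>The truncated integrals are holomorphic by differentiation under the integral sign and
  converge uniformly on discs.\<close>

lemma Gamma_upper_holomorphic:
  assumes "Re z > 0"
  shows "(\<lambda>a. Gamma_upper a z) holomorphic_on UNIV"
proof (rule holomorphic_uniform_sequence[where f = "\<lambda>n a. integral (cbox 0 (real n)) (\<lambda>t. (z + of_real t) powr (a - 1) * exp (- (z + of_real t)))"])
  fix n
  show "(\<lambda>a. integral (cbox 0 (real n)) (\<lambda>t. (z + of_real t) powr (a - 1) * exp (- (z + of_real t)))) holomorphic_on UNIV"
  proof (rule leibniz_rule_holomorphic)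
    show "((\<lambda>a. (z + of_real t) powr (a - 1) * exp (- (z + of_real t))) has_field_derivative
        Ln (z + of_real t) * (z + of_real t) powr (a - 1) * exp (- (z + of_real t))) (at a within UNIV)"
      if "t \<in> cbox 0 (real n)" for a t
    proof -
      have "z + of_real t \<noteq> 0" using that assms by (auto simp: complex_eq_iff)
      then show ?thesis
        by (auto intro!: derivative_eq_intros DERIV_chain2[OF has_field_derivative_powr_right])
    qed
    show "(\<lambda>t. (z + of_real t) powr (a - 1) * exp (- (z + of_real t))) integrable_on cbox 0 (real n)" for a
      using assms by (intro integrable_continuous continuous_intros) (auto simp: complex_eq_iff complex_nonpos_Reals_iff)
    show "continuous_on (UNIV \<times> cbox 0 (real n))
      (\<lambda>(a, t). Ln (z + of_real t) * (z + of_real t) powr (a - 1) * exp (- (z + of_real t)))"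
      using assms unfolding split_def
      by (intro continuous_intros) (auto simp: complex_eq_iff complex_nonpos_Reals_iff)
  qed auto
next
  fix a0 :: complex
  have "compact {z}" by simp
  obtain \<delta> K where dK: "\<delta> > 0" "K \<ge> 1" "Re z \<ge> \<delta> \<and> cmod z \<le> K * Re z"
    using Re_pos_compact_bounds[OF \<open>compact {z}\<close>] assms by (metis singletonD singletonI)
  obtain C where C: "\<And>a z n. \<lbrakk>cmod a \<le> cmod a0 + 1; Re z \<ge> \<delta>; cmod z \<le> K * Re z\<rbrakk> \<Longrightarrow>
       cmod (Gamma_upper a (z + of_nat n)) \<le> C * exp (- real n / 2)"
    using Gamma_upper_shift_uniform[OF dK(1,2)] by blast
  have "uniform_limit (cball a0 1) (\<lambda>n a. integral (cbox 0 (real n)) (\<lambda>t. (z + of_real t) powr (a - 1) * exp (- (z + of_real t))))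
     (\<lambda>a. Gamma_upper a z) sequentially"
  proof (rule uniform_limit_norm_le[OF _ tendsto_exp_neg_half])
    fix n a assume "a \<in> cball a0 1"
    then have "cmod a \<le> cmod a0 + 1" using norm_triangle_ineq2[of a a0] by (auto simp: dist_norm norm_minus_commute)
    then show "cmod (integral (cbox 0 (real n)) (\<lambda>t. (z + of_real t) powr (a - 1) * exp (- (z + of_real t))) - Gamma_upper a z)
       \<le> C * exp (- real n / 2)"
      using C[of a z n] dK Gamma_upper_split[OF assms, of "real n" a] by simp
  qed
  then show "\<exists>d>0. cball a0 d \<subseteq> UNIV \<and> uniform_limit (cball a0 d) (\<lambda>n a. integral (cbox 0 (real n)) (\<lambda>t. (z + of_real t) powr (a - 1) * exp (- (z + of_real t))))
     (\<lambda>a. Gamma_upper a z) sequentially"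
    using zero_less_one by blast
qed auto

text \<open>With a primitive \<open>P\<close> of the integrand \<open>f\<close> on the right
  half-plane, the truncated integral is \<open>P (w + n) - P w\<close>. Its derivative is
  \<open>f (w + n) - f w\<close>; local uniform convergence carries derivatives to the limit, and
  the first term decays.\<close>

lemma Gamma_upper_has_field_derivative:
  assumes "Re z > 0"
  shows "(Gamma_upper a has_field_derivative - (z powr (a - 1) * exp (- z))) (at z)"
proof -
  define S where "S = {z. Re z > 0}"
  define f where "f = (\<lambda>w. w powr (a - 1) * exp (- w))"
  have S: "open S" "convex S" unfolding S_def by (auto simp: open_halfspace_Re_gt convex_halfspace_Re_gt)
  have "f holomorphic_on S"
    unfolding f_def S_def by (intro holomorphic_intros) (auto simp: complex_nonpos_Reals_iff)
  then obtain P where P: "\<And>w. w \<in> S \<Longrightarrow> (P has_field_derivative f w) (at w)"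
    using holomorphic_convex_primitive'[OF S(2,1)] S(1) by (metis at_within_open)
  have int: "integral {0..real n} (\<lambda>t. f (w + of_real t)) = P (w + of_nat n) - P w" if "w \<in> S" for w n
  proof -
    have "((\<lambda>t. f (w + of_real t)) has_integral (P (w + of_real (real n)) - P (w + of_real 0))) {0..real n}"
    proof (rule fundamental_theorem_of_calculus)
      fix t assume "t \<in> {0..real n}"
      then have "w + of_real t \<in> S" using that by (auto simp: S_def)
      note 1 = has_field_derivative_at_within[OF P[OF this], of "(\<lambda>t. w + of_real t) ` {0..real n}"]
      have "((\<lambda>t. w + of_real t) has_vector_derivative 1) (at t within {0..real n})"
        by (auto intro!: derivative_eq_intros)
      from field_vector_diff_chain_within[OF this 1]
      show "((\<lambda>t. P (w + of_real t)) has_vector_derivative f (w + of_real t)) (at t within {0..real n})"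
        by (simp add: o_def)
    qed auto
    then show ?thesis by (simp add: integral_unique)
  qed
  have "\<exists>g'. \<forall>x\<in>S. (Gamma_upper a has_field_derivative g' x) (at x) \<and> ((\<lambda>n. f (x + of_nat n) - f x) \<longlonglongrightarrow> g' x)"
  proof (rule has_complex_derivative_uniform_sequence[OF S(1)])
    show "((\<lambda>w. P (w + of_nat n) - P w) has_field_derivative f (w + of_nat n) - f w) (at w)" if "w \<in> S" for n w
    proof -
      have 1: "w + of_nat n \<in> S" using that by (auto simp: S_def)
      show ?thesis using P[OF 1] P[OF that]
        by (auto intro!: derivative_eq_intros DERIV_chain2[where f = P])
    qed
    fix w assume w: "w \<in> S"
    obtain d where d: "d > 0" "cball w d \<subseteq> S" using S w open_contains_cball by blast
    obtain \<delta> K where dK: "\<delta> > 0" "K \<ge> 1" "\<And>z. z \<in> cball w d \<Longrightarrow> Re z \<ge> \<delta> \<and> cmod z \<le> K * Re z"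
      using Re_pos_compact_bounds[OF compact_cball, of w d] d(2) unfolding S_def by blast
    obtain C where C: "\<And>b z n. \<lbrakk>cmod b \<le> cmod a; Re z \<ge> \<delta>; cmod z \<le> K * Re z\<rbrakk> \<Longrightarrow>
       cmod (Gamma_upper b (z + of_nat n)) \<le> C * exp (- real n / 2)"
      using Gamma_upper_shift_uniform[OF dK(1,2)] by blast
    have "uniform_limit (cball w d) (\<lambda>n w. P (w + of_nat n) - P w) (Gamma_upper a) sequentially"
    proof (rule uniform_limit_norm_le[OF _ tendsto_exp_neg_half])
      fix n z assume z: "z \<in> cball w d"
      then have "z \<in> S" using d by auto
      show "cmod (P (z + of_nat n) - P z - Gamma_upper a z) \<le> C * exp (- real n / 2)"
        using C[of a z n] dK(3)[OF z] Gamma_upper_split[of z "real n" a] int[OF \<open>z \<in> S\<close>] \<open>z \<in> S\<close> by (simp add: f_def S_def)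
    qed
    then show "\<exists>d>0. cball w d \<subseteq> S \<and> uniform_limit (cball w d) (\<lambda>n w. P (w + of_nat n) - P w) (Gamma_upper a) sequentially"
      using d by blast
  qed
  then obtain g' where g': "(Gamma_upper a has_field_derivative g') (at z)" "(\<lambda>n. f (z + of_nat n) - f z) \<longlonglongrightarrow> g'"
    using assms unfolding S_def by blast
  have "(\<lambda>n. f (z + of_nat n)) \<longlonglongrightarrow> 0"
  proof -
    define K where "K = max 1 (cmod z / Re z)"
    have K: "cmod z \<le> K * Re z" "K \<ge> 1" unfolding K_def using assms by (auto simp add: max_mult_distrib_right)
    obtain C where C: "C > 0"
      "\<And>b w. \<lbrakk>cmod b \<le> cmod a; Re w \<ge> Re z; cmod w \<le> K * Re w\<rbrakk> \<Longrightarrow>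
       cmod (w powr (b - 1) * exp (- w)) \<le> C * exp (- Re w / 2)"
      using norm_Gamma_upper_integrand_le[OF assms, of "cmod a" K] by metis
    show ?thesis
    proof (rule Lim_null_comparison[OF always_eventually tendsto_exp_neg_half[of C]], rule allI)
      fix n
      have "cmod (z + of_nat n) \<le> cmod z + real n" using norm_triangle_ineq[of z "of_nat n"] by simp
      also have "\<dots> \<le> K * Re z + K * real n"
        using K mult_right_mono[OF K(2), of "real n"] by simp
      finally have "cmod (z + of_nat n) \<le> K * Re (z + of_nat n)" by (simp add: algebra_simps)
      then have "cmod (f (z + of_nat n)) \<le> C * exp (- Re (z + of_nat n) / 2)"
        unfolding f_def by (intro C(2)) auto
      also have "\<dots> \<le> C * exp (- real n / 2)"
        using C assms by (intro mult_left_mono) auto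
      finally show "cmod (f (z + of_nat n)) \<le> C * exp (- real n / 2)" .
    qed
  qed
  from tendsto_diff[OF this tendsto_const[of "f z"]] have "g' = - f z"
    using LIMSEQ_unique g'(2) by fastforce
  then show ?thesis using g'(1) by (simp add: f_def)
qed

section \<open>Positive real lower limits: comparison with Euler's integral\<close>

lemma Gamma_upper_of_real:
  assumes "y > 0"
  shows "(\<lambda>t. of_real t powr (a - 1) / of_real (exp t) :: complex) absolutely_integrable_on {y..}"
    "Gamma_upper a (of_real y) = integral {y..} (\<lambda>t. of_real t powr (a - 1) / of_real (exp t))"
proof -
  have eq: "(\<lambda>t::real. (0 + of_real t) powr (a - 1) * exp (- (0 + of_real t))) = (\<lambda>t. of_real t powr (a - 1) / of_real (exp t) :: complex)"
    by (simp add: exp_minus exp_of_real[symmetric] field_simps)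
  from Gamma_upper_shift[of 0 y a] assms show
   "(\<lambda>t. of_real t powr (a - 1) / of_real (exp t) :: complex) absolutely_integrable_on {y..}"
    "Gamma_upper a (of_real y) = integral {y..} (\<lambda>t. of_real t powr (a - 1) / of_real (exp t))"
    unfolding eq by auto
qed

text \<open>The integral of the norm over the whole positive axis is finite for
  \<open>Re a > 0\<close> and bounds every tail. Uniformity down to \<open>y = 0\<close> is what
  dominates the series when the split point tends to 0.\<close>

lemma Gamma_upper_le_real:
  assumes "Re a > 0"
  obtains G where "\<And>y. y > 0 \<Longrightarrow> cmod (Gamma_upper a (of_real y)) \<le> G"
proof -
  define f :: "real \<Rightarrow> complex" where "f = (\<lambda>t. of_real t powr (a - 1) / of_real (exp t))"
  have ai: "f absolutely_integrable_on {0<..}"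
    unfolding f_def by (rule absolutely_integrable_Gamma_integral'[OF assms])
  have n0: "(\<lambda>t. cmod (f t)) integrable_on {0<..}"
    using absolutely_integrable_norm[OF ai] set_lebesgue_integral_eq_integral(1) unfolding o_def by blast
  have "cmod (Gamma_upper a (of_real y)) \<le> integral {0<..} (\<lambda>t. cmod (f t))" if "y > 0" for y
  proof -
    have aiy: "f absolutely_integrable_on {y..}" using Gamma_upper_of_real(1)[OF that] unfolding f_def .
    have ny: "(\<lambda>t. cmod (f t)) integrable_on {y..}"
      using absolutely_integrable_norm[OF aiy] set_lebesgue_integral_eq_integral(1) unfolding o_def by blast
    have "cmod (Gamma_upper a (of_real y)) \<le> integral {y..} (\<lambda>t. cmod (f t))"
      unfolding Gamma_upper_of_real(2)[OF that] f_def[symmetric]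
      by (rule integral_norm_bound_integral[OF set_lebesgue_integral_eq_integral(1)[OF aiy] ny]) auto
    also have "\<dots> \<le> integral {0<..} (\<lambda>t. cmod (f t))"
      by (rule integral_subset_le) (use that n0 ny in auto)
    finally show ?thesis .
  qed
  then show ?thesis using that by blast
qed

text \<open>The missing piece is the integral over \<open>{0..y}\<close>, which is continuous in its
  upper limit.\<close>

lemma Gamma_upper_tendsto_Gamma:
  assumes "Re a > 0"
  shows "((\<lambda>y. Gamma_upper a (of_real y)) \<longlongrightarrow> Gamma a) (at_right 0)"
proof -
  define f :: "real \<Rightarrow> complex" where "f = (\<lambda>t. of_real t powr (a - 1) / of_real (exp t))"
  have hi: "(f has_integral Gamma a) {0..}" unfolding f_def by (rule Gamma_integral_complex[OF assms])
  have f1: "f integrable_on {0..y}" for y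
    using integrable_on_subinterval[OF has_integral_integrable[OF hi], of 0 y] by auto
  have eq: "Gamma a - integral {0..y} f = Gamma_upper a (of_real y)" if "y > 0" for y
  proof -
    have un: "{0..} = {0..y} \<union> {y..}" using that by auto
    have "{0..y} \<inter> {y..} \<subseteq> {y}" by auto
    then have "negligible ({0..y} \<inter> {y..})" using negligible_subset negligible_sing by blast
    then have "integral {0..} f = integral {0..y} f + integral {y..} f"
      unfolding un using f1 set_lebesgue_integral_eq_integral(1)[OF Gamma_upper_of_real(1)[OF that, of a]]
      by (intro Henstock_Kurzweil_Integration.integral_Un) (auto simp: f_def)
    then show ?thesis using hi Gamma_upper_of_real(2)[OF that, of a] by (simp add: f_def integral_unique)
  qed
  have "continuous_on {0..1} (\<lambda>x. integral {0..x} f)"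
    by (rule indefinite_integral_continuous_1[OF f1])
  then have "((\<lambda>x. integral {0..x} f) \<longlongrightarrow> integral {0..0} f) (at 0 within {0..1})"
    unfolding continuous_on_def by (drule_tac bspec[of _ _ 0]) auto
  then have "((\<lambda>x. integral {0..x} f) \<longlongrightarrow> 0) (at_right 0)"
    by (simp add: at_within_Icc_at_right)
  from tendsto_diff[OF tendsto_const[of "Gamma a"] this]
  have "((\<lambda>y. Gamma a - integral {0..y} f) \<longlongrightarrow> Gamma a) (at_right 0)" by simp
  then show ?thesis
    by (rule Lim_transform_eventually) (auto simp: eq eventually_at_right_less intro!: eventually_mono[OF eventually_at_right_less])
qed

section \<open>Fourier series of entire functions\<close>

text \<open>The character carries the sign used in Fourier coefficients and is extended to complex
  arguments, so that the integrands below are holomorphic and have primitives.\<close>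

definition fourier_char :: "int \<Rightarrow> complex \<Rightarrow> complex" where
  "fourier_char k z = exp (- 2 * of_real pi * \<i> * of_int k * z)"

lemma fourier_char_has_field_derivative [derivative_intros]:
  assumes "(f has_field_derivative f') (at z)"
  shows "((\<lambda>z. fourier_char k (f z)) has_field_derivative - 2 * of_real pi * \<i> * of_int k * f' * fourier_char k (f z)) (at z)"
  unfolding fourier_char_def using assms by (auto intro!: derivative_eq_intros)

lemma fourier_char_holomorphic [holomorphic_intros]:
  assumes "f holomorphic_on S"
  shows "(\<lambda>z. fourier_char k (f z)) holomorphic_on S"
  unfolding fourier_char_def using assms by (intro holomorphic_intros)

lemma fourier_char_continuous [continuous_intros]:
  assumes "continuous_on S f"
  shows "continuous_on S (\<lambda>z. fourier_char k (f z))"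
  unfolding fourier_char_def using assms by (intro continuous_intros)

lemma norm_fourier_char_of_real [simp]: "cmod (fourier_char k (of_real u)) = 1"
  by (simp add: fourier_char_def)

lemma fourier_char_0 [simp]: "fourier_char 0 z = 1" "fourier_char k 0 = 1"
  by (simp_all add: fourier_char_def)

lemma fourier_char_add: "fourier_char (k + l) z = fourier_char k z * fourier_char l z"
  by (simp add: fourier_char_def exp_add[symmetric] algebra_simps)

lemma fourier_char_of_int: "fourier_char k (of_int n) = 1"
  unfolding fourier_char_def exp_eq_1 by (auto intro!: exI[of _ "- k * n"])

lemma fourier_char_add_arg: "fourier_char k (z + w) = fourier_char k z * fourier_char k w"
  by (simp add: fourier_char_def exp_add[symmetric] algebra_simps)

text \<open>In this strip 0 is the only zero of \<open>fourier_char (-1) z - 1\<close>, so division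
  by that difference leaves just one singularity to remove.\<close>

lemma fourier_char_eq_1_iff:
  assumes "\<bar>Re z\<bar> < 1"
  shows "fourier_char (-1) z = 1 \<longleftrightarrow> z = 0"
proof
  assume "fourier_char (-1) z = 1"
  then obtain n where "Re (2 * of_real pi * \<i> * z) = 0" "Im (2 * of_real pi * \<i> * z) = of_int (2 * n) * pi"
    by (auto simp: fourier_char_def exp_eq_1)
  then have "Im z = 0" "Re z = of_int n" by auto
  with assms show "z = 0" by (auto simp: complex_eq_iff)
qed (auto simp: fourier_char_def)

lemma fourier_char_integral:
  "((\<lambda>u. fourier_char k (of_real u)) has_integral (if k = 0 then 1 else 0)) {-1/2..1/2}"
proof (cases "k = 0")
  case True
  then show ?thesis using has_integral_const_real[of "1::complex" "-1/2" "1/2"] by simp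
next
  case False
  define c where "c = - 2 * of_real pi * \<i> * of_int k"
  have c: "c \<noteq> 0" using False by (simp add: c_def)
  have "((\<lambda>u. fourier_char k (of_real u)) has_integral
     (fourier_char k (of_real (1/2)) / c - fourier_char k (of_real (-1/2)) / c)) {-1/2..1/2}"
  proof (rule fundamental_theorem_of_calculus)
    show "((\<lambda>u. fourier_char k (of_real u) / c) has_vector_derivative fourier_char k (of_real u)) (at u within {-1/2..1/2})" for u
      using c by (intro has_vector_derivative_real_field[of "\<lambda>z. fourier_char k z / c"])
        (auto intro!: derivative_eq_intros simp: c_def)
  qed auto
  moreover have "fourier_char k (of_real (1/2)) = fourier_char k (of_real (-1/2) + of_int 1)" by simp
  then have "fourier_char k (of_real (1/2)) = fourier_char k (of_real (-1/2))"
    unfolding fourier_char_add_arg fourier_char_of_int by simp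
  ultimately show ?thesis using False by simp
qed

text \<open>Integration by parts. As \<open>q\<close> need not be periodic, the boundary terms stay
  and the decay is only of order \<open>1 / \<bar>k\<bar>\<close>, which is enough for a telescoping
  sum. In the constant, \<open>2 * A\<close> comes from the endpoints, \<open>A'\<close> from the
  integral of the derivative and \<open>2 * pi\<close> from \<open>cmod c\<close>.\<close>

lemma fourier_coefficient_bound:
  assumes "open U" "q holomorphic_on U" "of_real ` {-1/2..1/2} \<subseteq> U"
  obtains B where "\<And>k. k \<noteq> 0 \<Longrightarrow>
    cmod (integral {-1/2..1/2} (\<lambda>u. q (of_real u) * fourier_char k (of_real u))) \<le> B / \<bar>of_int k\<bar>"
proof -
  have U: "of_real u \<in> U" if "u \<in> {-1/2..1/2}" for u using assms(3) that by blast
  have dq: "deriv q holomorphic_on U" by (rule holomorphic_deriv[OF assms(2,1)])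
  have cq: "continuous_on {-1/2..1/2} (\<lambda>u. q (of_real u))" "continuous_on {-1/2..1/2} (\<lambda>u. deriv q (of_real u))"
    using U by (auto intro!: continuous_on_compose2[OF holomorphic_on_imp_continuous_on[OF assms(2)]]
       continuous_on_compose2[OF holomorphic_on_imp_continuous_on[OF dq]] continuous_intros)
  obtain A where A: "\<And>u. u \<in> {-1/2..1/2} \<Longrightarrow> cmod (q (of_real u)) \<le> A"
    using compact_imp_bounded[OF compact_continuous_image[OF cq(1) compact_Icc]]
    unfolding bounded_iff by blast
  obtain A' where A': "\<And>u. u \<in> {-1/2..1/2} \<Longrightarrow> cmod (deriv q (of_real u)) \<le> A'"
    using compact_imp_bounded[OF compact_continuous_image[OF cq(2) compact_Icc]]
    unfolding bounded_iff by blast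
  have "cmod (integral {-1/2..1/2} (\<lambda>u. q (of_real u) * fourier_char k (of_real u))) \<le> ((2 * A + A') / (2 * pi)) / \<bar>of_int k\<bar>"
    if "k \<noteq> 0" for k
  proof -
    define c where "c = - 2 * of_real pi * \<i> * of_int k"
    have c: "c \<noteq> 0" "cmod c = 2 * pi * \<bar>of_int k\<bar>" using that by (auto simp: c_def norm_mult)
    define G where "G = (\<lambda>z. q z * fourier_char k z)"
    have "((\<lambda>u. deriv q (of_real u) * fourier_char k (of_real u) + c * (q (of_real u) * fourier_char k (of_real u)))
        has_integral (G (of_real (1/2)) - G (of_real (-1/2)))) {-1/2..1/2}"
    proof (rule fundamental_theorem_of_calculus)
      fix u :: real assume u: "u \<in> {-1/2..1/2}"
      have "(q has_field_derivative deriv q (of_real u)) (at (of_real u))"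
        using assms U[OF u] by (metis holomorphic_derivI)
      then have "(G has_field_derivative deriv q (of_real u) * fourier_char k (of_real u) + c * (q (of_real u) * fourier_char k (of_real u)))
         (at (of_real u))"
        unfolding G_def c_def by (auto intro!: derivative_eq_intros simp: algebra_simps)
      then show "((\<lambda>u. G (of_real u)) has_vector_derivative
          deriv q (of_real u) * fourier_char k (of_real u) + c * (q (of_real u) * fourier_char k (of_real u))) (at u within {-1/2..1/2})"
        by (rule has_vector_derivative_real_field)
    qed auto
    moreover have i1: "(\<lambda>u. deriv q (of_real u) * fourier_char k (of_real u)) integrable_on {-1/2..1/2}"
      and i2: "(\<lambda>u. q (of_real u) * fourier_char k (of_real u)) integrable_on {-1/2..1/2}"
      by (intro integrable_continuous_interval continuous_intros cq)+
    ultimately have "integral {-1/2..1/2} (\<lambda>u. deriv q (of_real u) * fourier_char k (of_real u)) +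
       c * integral {-1/2..1/2} (\<lambda>u. q (of_real u) * fourier_char k (of_real u)) = G (of_real (1/2)) - G (of_real (-1/2))"
      by (subst integral_mult_right[symmetric], subst Henstock_Kurzweil_Integration.integral_add[symmetric])
         (auto intro!: integrable_on_mult_right integral_unique)
    then have "c * integral {-1/2..1/2} (\<lambda>u. q (of_real u) * fourier_char k (of_real u)) =
      G (of_real (1/2)) - G (of_real (-1/2)) - integral {-1/2..1/2} (\<lambda>u. deriv q (of_real u) * fourier_char k (of_real u))"
      by (simp add: algebra_simps)
    then have "cmod (c * integral {-1/2..1/2} (\<lambda>u. q (of_real u) * fourier_char k (of_real u))) \<le>
      cmod (G (of_real (1/2))) + cmod (G (of_real (-1/2))) + cmod (integral {-1/2..1/2} (\<lambda>u. deriv q (of_real u) * fourier_char k (of_real u)))"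
      using norm_triangle_ineq4[of "G (of_real (1/2)) - G (of_real (-1/2))" "integral {-1/2..1/2} (\<lambda>u. deriv q (of_real u) * fourier_char k (of_real u))"]
        norm_triangle_ineq4[of "G (of_real (1/2))" "G (of_real (-1/2))"] by simp
    also have "\<dots> \<le> A + A + A'"
    proof (intro add_mono)
      show "cmod (G (of_real (1/2))) \<le> A" "cmod (G (of_real (-1/2))) \<le> A"
        unfolding G_def norm_mult norm_fourier_char_of_real using A[of "1/2"] A[of "-1/2"] by simp_all
      have "cmod (integral {-1/2..1/2} (\<lambda>u. deriv q (of_real u) * fourier_char k (of_real u))) \<le> A' * (1/2 - -1/2)"
      proof (rule integral_bound)
        show "continuous_on {-1/2..1/2} (\<lambda>u. deriv q (of_real u) * fourier_char k (of_real u))"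
          by (intro continuous_intros cq)
        show "cmod (deriv q (of_real u) * fourier_char k (of_real u)) \<le> A'" if "u \<in> {-1/2..1/2}" for u
          using A'[OF that] by (simp add: norm_mult)
      qed simp
      then show "cmod (integral {-1/2..1/2} (\<lambda>u. deriv q (of_real u) * fourier_char k (of_real u))) \<le> A'" by simp
    qed
    finally show ?thesis using c that unfolding norm_mult by (simp add: field_simps)
  qed
  then show ?thesis using that by blast
qed

text \<open>
  With \<open>g - g 0 = q * (fourier_char (-1) - 1)\<close>, the Fourier coefficients of \<open>g - g 0\<close> are
  differences of consecutive Fourier coefficients of \<open>q\<close>, so their symmetric sums telescope.
\<close>
lemma fourier_symmetric_sums_tendsto:
  fixes g :: "complex \<Rightarrow> complex"
  assumes g: "g holomorphic_on UNIV"
  shows "(\<lambda>N. \<Sum>k = - int N..int N. integral {-1/2..1/2} (\<lambda>u. g (of_real u) * fourier_char k (of_real u))) \<longlonglongrightarrow> g 0"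
proof -
  \<comment> \<open>The strip contains the closed period interval and stops before the neighbouring
    zeros \<open>1\<close> and \<open>-1\<close> of \<open>fourier_char (-1) z - 1\<close>.\<close>
  define U where "U = {z. \<bar>Re z\<bar> < 1}"
  have "U = {z. Re z < 1} \<inter> {z. Re z > -1}" by (auto simp: U_def)
  then have openU: "open U" by (simp add: open_Int open_halfspace_Re_gt open_halfspace_Re_lt)
  define e where "e = fourier_char (-1)"
  have e: "e holomorphic_on UNIV" unfolding e_def by (intro holomorphic_intros)
  \<comment> \<open>Dividing numerator and denominator by \<open>z\<close> first turns
    \<open>q\<close> into a quotient of two entire functions, whose denominator at 0 is
    \<open>deriv e 0 = 2 * pi * \<i>\<close>. The singularity at 0 has thereby been removed.\<close>
  define N where "N = (\<lambda>z. if z = 0 then deriv g 0 else (g z - g 0) / (z - 0))"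
  define D where "D = (\<lambda>z. if z = 0 then deriv e 0 else (e z - e 0) / (z - 0))"
  define q where "q = (\<lambda>z. N z / D z)"
  have "(e has_field_derivative 2 * of_real pi * \<i>) (at 0)"
    unfolding e_def by (auto intro!: derivative_eq_intros)
  then have "deriv e 0 \<noteq> 0" by (simp add: DERIV_imp_deriv)
  then have D0: "D z \<noteq> 0" if "z \<in> U" for z
    using fourier_char_eq_1_iff[of z] that by (auto simp: D_def e_def U_def)
  have "N holomorphic_on UNIV" "D holomorphic_on UNIV"
    unfolding N_def D_def by (intro pole_lemma_open g e open_UNIV)+
  then have q: "q holomorphic_on U"
    unfolding q_def using D0 by (intro holomorphic_on_divide) (auto intro: holomorphic_on_subset)
  have qe: "g z = g 0 + q z * (e z - 1)" if "z \<in> U" for z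
    using D0[OF that] by (cases "z = 0") (auto simp: q_def N_def D_def e_def divide_simps)
  have U: "of_real u \<in> U" if "u \<in> {-1/2..1/2}" for u using that by (auto simp: U_def)
  have cq: "continuous_on {-1/2..1/2} (\<lambda>u. q (of_real u))"
    using U by (auto intro!: continuous_on_compose2[OF holomorphic_on_imp_continuous_on[OF q]] continuous_intros)
  define d where "d = (\<lambda>k. integral {-1/2..1/2} (\<lambda>u. q (of_real u) * fourier_char k (of_real u)))"
  define c where "c = (\<lambda>k. integral {-1/2..1/2} (\<lambda>u. g (of_real u) * fourier_char k (of_real u)))"
  have c: "c k = g 0 * (if k = 0 then 1 else 0) + (d (k - 1) - d k)" for k
  proof -
    have qi: "((\<lambda>u. q (of_real u) * fourier_char k (of_real u)) has_integral d k) {-1/2..1/2}" for k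
      unfolding d_def by (intro integrable_integral integrable_continuous_interval continuous_intros cq)
    have "((\<lambda>u. g 0 * fourier_char k (of_real u) + (q (of_real u) * fourier_char (k - 1) (of_real u) - q (of_real u) * fourier_char k (of_real u)))
      has_integral (g 0 * (if k = 0 then 1 else 0) + (d (k - 1) - d k))) {-1/2..1/2}"
      by (intro has_integral_add has_integral_diff has_integral_mult_right qi fourier_char_integral)
    then have "((\<lambda>u. g (of_real u) * fourier_char k (of_real u))
      has_integral (g 0 * (if k = 0 then 1 else 0) + (d (k - 1) - d k))) {-1/2..1/2}"
    proof (rule has_integral_eq[rotated])
      fix u :: real assume "u \<in> {-1/2..1/2}"
      have "fourier_char (k - 1) (of_real u) = fourier_char k (of_real u) * e (of_real u)"
        unfolding e_def using fourier_char_add[of k "-1" "of_real u"] by simp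
      then show "g 0 * fourier_char k (of_real u) + (q (of_real u) * fourier_char (k - 1) (of_real u) - q (of_real u) * fourier_char k (of_real u))
         = g (of_real u) * fourier_char k (of_real u)"
        unfolding qe[OF U[OF \<open>u \<in> {-1/2..1/2}\<close>]] by (simp add: algebra_simps)
    qed
    then show ?thesis unfolding c_def by (rule integral_unique)
  qed
  \<comment> \<open>The constant \<open>g 0\<close> contributes only through \<open>k = 0\<close>;
    of the differences, the two extreme coefficients survive, and both tend to 0.\<close>
  have sum: "(\<Sum>k = - int N..int N. c k)
    = g 0 + (d (- int N - 1) - d (int N))" for N
  proof (induction N)
    case 0
    then show ?case by (simp add: c)
  next
    case (Suc N)
    have eq: "{- int (Suc N)..int (Suc N)} = insert (- int (Suc N)) (insert (int (Suc N)) {- int N..int N})" by auto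
    have sg: "- int (Suc N) - 1 = - int N - 2" "int (Suc N) - 1 = int N" "- int (Suc N) = - int N - 1" by auto
    have "(\<Sum>k = - int (Suc N)..int (Suc N). c k)
      = (d (- int (Suc N) - 1) - d (- int (Suc N))) + ((d (int (Suc N) - 1) - d (int (Suc N))) + (g 0 + (d (- int N - 1) - d (int N))))"
      unfolding eq Suc[symmetric] using c[of "- int (Suc N)"] c[of "int (Suc N)"]
      by (simp del: of_nat_Suc)
    also have "\<dots> = g 0 + (d (- int (Suc N) - 1) - d (int (Suc N)))"
      unfolding sg by simp
    finally show ?case .
  qed
  obtain B where B: "\<And>k. k \<noteq> 0 \<Longrightarrow> cmod (d k) \<le> B / \<bar>of_int k\<bar>"
    unfolding d_def by (rule fourier_coefficient_bound[OF openU q]) (use U in blast)+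
  have "(\<lambda>N. d (int N)) \<longlonglongrightarrow> 0"
  proof (rule Lim_null_comparison)
    show "\<forall>\<^sub>F N in sequentially. cmod (d (int N)) \<le> B / real N"
      using eventually_gt_at_top[of 0]
    proof eventually_elim
      case (elim N)
      then show ?case using B[of "int N"] by simp
    qed
  qed real_asymp
  moreover have "(\<lambda>N. d (- int N - 1)) \<longlonglongrightarrow> 0"
  proof (rule Lim_null_comparison)
    show "\<forall>\<^sub>F N in sequentially. cmod (d (- int N - 1)) \<le> B / (real N + 1)"
    proof (intro always_eventually allI)
      fix N
      have "\<bar>real_of_int (- int N - 1)\<bar> = real N + 1" by simp
      moreover have "- int N - 1 \<noteq> 0" by simp
      ultimately show "cmod (d (- int N - 1)) \<le> B / (real N + 1)" using B[of "- int N - 1"] by (simp add: add.commute)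
    qed
  qed real_asymp
  ultimately have "(\<lambda>N. g 0 + (d (- int N - 1) - d (int N))) \<longlonglongrightarrow> g 0 + (0 - 0)"
    by (intro tendsto_intros)
  then show ?thesis unfolding sum c_def[symmetric] by simp
qed

section \<open>The theta functional equation\<close>

definition gaussian :: "real \<Rightarrow> complex \<Rightarrow> complex" where
  "gaussian t z = exp (- (of_real (pi * t) * z ^ 2))"

lemma gaussian_holomorphic [holomorphic_intros]:
  assumes "f holomorphic_on S"
  shows "(\<lambda>z. gaussian t (f z)) holomorphic_on S"
  unfolding gaussian_def using assms by (intro holomorphic_intros)

lemma gaussian_continuous [continuous_intros]:
  assumes "continuous_on S f"
  shows "continuous_on S (\<lambda>z. gaussian t (f z))"
  unfolding gaussian_def using assms by (intro continuous_intros)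

text \<open>This is the characteristic function of the standard normal distribution after the
  substitution by \<open>c = sqrt (2 * pi * t)\<close>.\<close>

lemma gaussian_fourier_lborel:
  assumes t: "t > 0"
  shows "integrable lborel (\<lambda>u. gaussian t (of_real u) * fourier_char k (of_real u))"
    and "(LINT u|lborel. gaussian t (of_real u) * fourier_char k (of_real u)) =
      of_real (exp (- (pi * of_int k ^ 2 / t)) / sqrt t)"
proof -
  define c where "c = sqrt (2 * pi * t)"
  have c: "c > 0" "c ^ 2 = 2 * pi * t" using t by (simp_all add: c_def)
  \<comment> \<open>Chosen so that \<open>s * c = - 2 * pi * k\<close>: the substitution then turns
    \<open>iexp\<close> into \<open>fourier_char k\<close>.\<close>
  define s where "s = - 2 * pi * of_int k / c"
  have sc: "s * c = - 2 * pi * of_int k" using c by (simp add: s_def)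
  define J where "J = (LINT u|lborel. gaussian t (of_real u) * fourier_char k (of_real u))"
  have "complex_of_real (exp (- (s^2) / 2)) = char std_normal_distribution s"
    by (simp add: char_std_normal_distribution)
  also have "\<dots> = (LINT x|lborel. std_normal_density x *\<^sub>R iexp (s * x))"
    unfolding char_def by (subst integral_density) auto
  also have "\<dots> = \<bar>c\<bar> *\<^sub>R (LINT x|lborel. std_normal_density (0 + c * x) *\<^sub>R iexp (s * (0 + c * x)))"
    by (rule lborel_integral_real_affine) (use c in auto)
  also have "(\<lambda>x. std_normal_density (0 + c * x) *\<^sub>R iexp (s * (0 + c * x))) =
     (\<lambda>u. of_real (1 / sqrt (2 * pi)) * (gaussian t (of_real u) * fourier_char k (of_real u)))"
  proof
    fix u
    have "iexp (s * (0 + c * u)) = fourier_char k (of_real u)"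
    proof -
      have "s * (0 + c * u) = (s * c) * u" by simp
      then have "s * (0 + c * u) = - 2 * pi * of_int k * u" unfolding sc .
      then show ?thesis by (simp add: fourier_char_def mult_ac)
    qed
    moreover have "std_normal_density (0 + c * u) = 1 / sqrt (2 * pi) * exp (- (pi * t * u^2))"
      unfolding std_normal_density_def using c by (simp add: power_mult_distrib)
    ultimately show "std_normal_density (0 + c * u) *\<^sub>R iexp (s * (0 + c * u)) =
       of_real (1 / sqrt (2 * pi)) * (gaussian t (of_real u) * fourier_char k (of_real u))"
      by (simp add: scaleR_conv_of_real gaussian_def exp_of_real[symmetric])
  qed
  also have "\<bar>c\<bar> *\<^sub>R (LINT u|lborel. of_real (1 / sqrt (2 * pi)) * (gaussian t (of_real u) * fourier_char k (of_real u))) =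
      of_real (c / sqrt (2 * pi)) * J"
    using c by (simp add: J_def scaleR_conv_of_real)
  also have "c / sqrt (2 * pi) = sqrt t" by (simp add: c_def real_sqrt_mult)
  finally have eq: "of_real (sqrt t) * J = complex_of_real (exp (- (s^2) / 2))" ..
  have "s^2 / 2 = pi * of_int k ^ 2 / t"
    unfolding s_def power_divide c(2) using t by (simp add: field_simps power2_eq_square)
  then have "- (s^2) / 2 = - (pi * of_int k ^ 2 / t)" by simp
  then have J: "J = of_real (exp (- (pi * of_int k ^ 2 / t)) / sqrt t)"
    using eq t by (simp add: field_simps)
  then show "(LINT u|lborel. gaussian t (of_real u) * fourier_char k (of_real u)) =
      of_real (exp (- (pi * of_int k ^ 2 / t)) / sqrt t)" by (simp add: J_def)
  \<comment> \<open>The Lebesgue integral of a non-integrable function is 0 by convention, so a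
    nonzero value certifies integrability.\<close>
  have "J \<noteq> 0" unfolding J using t by simp
  then show "integrable lborel (\<lambda>u. gaussian t (of_real u) * fourier_char k (of_real u))"
    unfolding J_def using not_integrable_integral_eq by blast
qed

text \<open>The endpoints are half-integers because these intervals are made of
  \<open>2 * M + 1\<close> translates of the period interval, matching the partial sums of the
  periodization.\<close>

lemma gaussian_fourier_tendsto:
  assumes t: "t > 0"
  shows "(\<lambda>M. integral {- (real M + 1/2)..real M + 1/2} (\<lambda>u. gaussian t (of_real u) * fourier_char k (of_real u)))
    \<longlonglongrightarrow> of_real (exp (- (pi * of_int k ^ 2 / t)) / sqrt t)"
proof -
  define f where "f = (\<lambda>u. gaussian t (of_real u) * fourier_char k (of_real u))"
  define A where "A = (\<lambda>M::nat. {- (real M + 1/2)..real M + 1/2})"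
  have un: "(\<Union>M. A M) = UNIV"
  proof (intro equalityI subsetI)
    fix x :: real
    obtain M where "\<bar>x\<bar> \<le> real M" using real_arch_simple by blast
    then show "x \<in> (\<Union>M. A M)" by (auto simp: A_def intro!: exI[of _ M])
  qed auto
  have int: "set_integrable lborel UNIV f"
    using gaussian_fourier_lborel(1)[OF t] unfolding f_def by (simp add: set_integrable_def)
  have "(\<lambda>M. LINT u:A M|lborel. f u) \<longlonglongrightarrow> (LINT u:(\<Union>M. A M)|lborel. f u)"
    by (rule set_integral_cont_up) (use int un in \<open>auto simp: A_def incseq_def\<close>)
  moreover have "(LINT u:(\<Union>M. A M)|lborel. f u) = of_real (exp (- (pi * of_int k ^ 2 / t)) / sqrt t)"
    unfolding un f_def using gaussian_fourier_lborel(2)[OF t, of k] by (simp add: set_lebesgue_integral_def)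
  moreover have "(LINT u:A M|lborel. f u) = integral (A M) f" for M
    by (rule set_borel_integral_eq_integral(2)[OF set_integrable_subset[OF int]]) (auto simp: A_def)
  ultimately show ?thesis unfolding f_def A_def by simp
qed

text \<open>The translates by \<open>n + 1\<close> and \<open>- (n + 1)\<close> are joined so that
  the two-sided periodization becomes a central term plus a series over the naturals.\<close>

definition gaussian_pair :: "real \<Rightarrow> nat \<Rightarrow> complex \<Rightarrow> complex" where
  "gaussian_pair t n z = gaussian t (z + of_nat (Suc n)) + gaussian t (z - of_nat (Suc n))"

text \<open>The square of \<open>2 * Re z + n\<close> is nonnegative, which bounds
  \<open>(Re z + n)\<^sup>2\<close> below by \<open>n\<^sup>2 / 2 - (Re z)\<^sup>2\<close>; then
  \<open>\<bar>n\<bar> \<le> n\<^sup>2\<close> weakens Gaussian decay to a geometric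
  majorant.\<close>

lemma norm_gaussian_shift_le:
  assumes t: "t > 0" and z: "cmod z \<le> R" and n: "\<bar>n\<bar> \<ge> 1"
  shows "cmod (gaussian t (z + of_int n)) \<le> exp (pi * t * R^2) * exp (- (pi * t / 2)) ^ nat \<bar>n\<bar>"
proof -
  have sq: "(of_int n)^2 \<le> 2 * (Re z + of_int n)^2 + 2 * (Re z)^2"
    using zero_le_power2[of "2 * Re z + of_int n"] by (simp add: power2_eq_square algebra_simps)
  have "(Re z)^2 + (Im z)^2 \<le> R^2"
    using z by (metis cmod_power2 norm_ge_zero power_mono)
  have "\<bar>n\<bar> * 1 \<le> \<bar>n\<bar> * \<bar>n\<bar>" using n by (intro mult_left_mono) auto
  then have "\<bar>n\<bar> \<le> n^2" by (simp add: power2_eq_square)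
  then have nn: "real (nat \<bar>n\<bar>) \<le> (of_int n)^2"
    by (metis (mono_tags) abs_ge_zero int_nat_eq of_int_le_iff of_int_of_nat_eq of_int_power)
  have "- ((Re z + of_int n)^2 - (Im z)^2) \<le> R^2 - real (nat \<bar>n\<bar>) / 2"
    using sq nn \<open>(Re z)^2 + (Im z)^2 \<le> R^2\<close> by linarith
  then have "pi * t * - ((Re z + of_int n)^2 - (Im z)^2) \<le> pi * t * (R^2 - real (nat \<bar>n\<bar>) / 2)"
    using t by (intro mult_left_mono) auto
  moreover have "cmod (gaussian t (z + of_int n)) = exp (pi * t * - ((Re z + of_int n)^2 - (Im z)^2))"
    by (simp add: gaussian_def Re_power2 algebra_simps)
  moreover have "exp (pi * t * R^2) * exp (- (pi * t / 2)) ^ nat \<bar>n\<bar> = exp (pi * t * (R^2 - real (nat \<bar>n\<bar>) / 2))"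
    by (simp add: exp_of_nat_mult[symmetric] exp_add[symmetric] algebra_simps)
  ultimately show ?thesis by simp
qed

lemma gaussian_pair_uniform_limit:
  assumes t: "t > 0"
  shows "uniform_limit (cball 0 R) (\<lambda>M z. gaussian t z + (\<Sum>n<M. gaussian_pair t n z))
    (\<lambda>z. gaussian t z + (\<Sum>n. gaussian_pair t n z)) sequentially"
proof (intro uniform_limit_add uniform_limit_const Weierstrass_m_test)
  define r where "r = exp (- (pi * t / 2))"
  have r: "0 < r" "r < 1" using t by (simp_all add: r_def)
  show "summable (\<lambda>n. 2 * (exp (pi * t * R^2) * r ^ Suc n))"
    using r by (intro summable_mult) (simp add: summable_geometric)
  fix n z assume "z \<in> cball (0::complex) R"
  then have z: "cmod z \<le> R" by simp
  have "cmod (gaussian_pair t n z) \<le> cmod (gaussian t (z + of_int (int (Suc n)))) + cmod (gaussian t (z + of_int (- int (Suc n))))"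
    unfolding gaussian_pair_def
    using norm_triangle_ineq[of "gaussian t (z + of_nat (Suc n))" "gaussian t (z - of_nat (Suc n))"]
    by (simp add: diff_conv_add_uminus del: of_nat_Suc add_uminus_conv_diff)
  also have "\<dots> \<le> exp (pi * t * R^2) * r ^ Suc n + exp (pi * t * R^2) * r ^ Suc n"
    using norm_gaussian_shift_le[OF t z, of "int (Suc n)"] norm_gaussian_shift_le[OF t z, of "- int (Suc n)"]
    unfolding r_def by (intro add_mono) (simp_all del: of_nat_Suc power_Suc)
  finally show "cmod (gaussian_pair t n z) \<le> 2 * (exp (pi * t * R^2) * r ^ Suc n)"
    by (simp add: mult_ac)
qed

text \<open>Unfolding of the periodization: the character has period 1, so translates of the
  Gaussian over one period interval become the Gaussian over adjacent intervals. A primitive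
  \<open>P\<close> of the entire integrand reduces the gluing to telescoping endpoint
  values.\<close>

lemma gaussian_periodization_fourier:
  "((\<lambda>u. (gaussian t (of_real u) + (\<Sum>n<M. gaussian_pair t n (of_real u))) * fourier_char k (of_real u)) has_integral
    integral {- (real M + 1/2)..real M + 1/2} (\<lambda>u. gaussian t (of_real u) * fourier_char k (of_real u))) {-1/2..1/2}"
proof -
  have "(\<lambda>z. gaussian t z * fourier_char k z) holomorphic_on UNIV"
    by (intro holomorphic_intros)
  then obtain P where P: "\<And>z. (P has_field_derivative gaussian t z * fourier_char k z) (at z)"
    using holomorphic_convex_primitive'[of UNIV "\<lambda>z. gaussian t z * fourier_char k z"] by auto
  have shifted: "((\<lambda>u. gaussian t (of_real u + of_int n) * fourier_char k (of_real u)) has_integral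
     (P (of_real (1/2) + of_int n) - P (of_real (-1/2) + of_int n))) {-1/2..1/2}" for n
  proof (rule fundamental_theorem_of_calculus)
    fix u :: real
    have "((\<lambda>z. P (z + of_int n)) has_field_derivative gaussian t (of_real u + of_int n) * fourier_char k (of_real u + of_int n)) (at (of_real u))"
      using P[of "of_real u + of_int n"] by (simp add: DERIV_shift)
    then show "((\<lambda>u. P (of_real u + of_int n)) has_vector_derivative gaussian t (of_real u + of_int n) * fourier_char k (of_real u)) (at u within {-1/2..1/2})"
      unfolding fourier_char_add_arg fourier_char_of_int
      by (intro has_vector_derivative_real_field[of "\<lambda>z. P (z + of_int n)"]) simp
  qed auto
  have "((\<lambda>u. (gaussian t (of_real u) + (\<Sum>n<M. gaussian_pair t n (of_real u))) * fourier_char k (of_real u)) has_integral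
    (P (of_real (real M + 1/2)) - P (of_real (- (real M + 1/2))))) {-1/2..1/2}"
  proof (induction M)
    case 0
    show ?case using shifted[of 0] by simp
  next
    case (Suc M)
    from has_integral_add[OF Suc has_integral_add[OF shifted[of "int (Suc M)"] shifted[of "- int (Suc M)"]]]
    have "((\<lambda>u. (gaussian t (of_real u) + (\<Sum>n<Suc M. gaussian_pair t n (of_real u))) * fourier_char k (of_real u)) has_integral
      (P (of_real (real M + 1/2)) - P (of_real (- (real M + 1/2))) +
       ((P (of_real (1/2) + of_int (int (Suc M))) - P (of_real (-1/2) + of_int (int (Suc M)))) +
       (P (of_real (1/2) + of_int (- int (Suc M))) - P (of_real (-1/2) + of_int (- int (Suc M))))))) {-1/2..1/2}"
      by (rule has_integral_eq[rotated]) (simp add: gaussian_pair_def algebra_simps)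
    moreover have "complex_of_real (1/2) + of_int (int (Suc M)) = of_real (real (Suc M) + 1/2)"
      "complex_of_real (-1/2) + of_int (int (Suc M)) = of_real (real M + 1/2)"
      "complex_of_real (1/2) + of_int (- int (Suc M)) = of_real (- (real M + 1/2))"
      "complex_of_real (-1/2) + of_int (- int (Suc M)) = of_real (- (real (Suc M) + 1/2))"
      by (simp_all add: complex_eq_iff)
    ultimately show ?case by (simp only:) (simp add: algebra_simps)
  qed
  moreover have "((\<lambda>u. gaussian t (of_real u) * fourier_char k (of_real u)) has_integral
    (P (of_real (real M + 1/2)) - P (of_real (- (real M + 1/2))))) {- (real M + 1/2)..real M + 1/2}"
    by (intro fundamental_theorem_of_calculus has_vector_derivative_real_field P) auto
  ultimately show ?thesis by (simp add: integral_unique)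
qed

text \<open>In terms of the Jacobi theta series, the sum of
  \<open>exp (- pi * n\<^sup>2 * t)\<close> over all integers \<open>n\<close>, this is (theta - 1)
  / 2; hence \<open>1 + 2 * theta_half t\<close> is the full series.\<close>

definition theta_half :: "real \<Rightarrow> real" where
  "theta_half t = (\<Sum>n. exp (- (pi * t * real (Suc n) ^ 2)))"

lemma theta_half_summable:
  assumes "t > 0"
  shows "summable (\<lambda>n. exp (- (pi * t * real (Suc n) ^ 2)))"
proof (rule summable_comparison_test[OF exI[of _ 0]], intro allI impI)
  show "summable (\<lambda>n. exp (- (pi * t)) ^ Suc n)"
    using assms by (simp add: summable_geometric)
  fix n
  have "real (Suc n) \<le> real (Suc n) ^ 2" by (simp add: power2_eq_square)
  then have "pi * t * real (Suc n) \<le> pi * t * real (Suc n) ^ 2" using assms by (intro mult_left_mono) auto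
  then show "norm (exp (- (pi * t * real (Suc n) ^ 2))) \<le> exp (- (pi * t)) ^ Suc n"
    by (simp add: exp_of_nat_mult[symmetric] mult_ac del: of_nat_Suc power_Suc)
qed

text \<open>Poisson summation at 0. The periodization \<open>g\<close> has the values of the Fourier
  transform of the Gaussian at the integers as its Fourier coefficients; the left side is
  \<open>g 0\<close> read off directly, the right side is \<open>g 0\<close> as the sum of its
  Fourier series.\<close>

lemma theta_half_functional_equation:
  assumes t: "t > 0"
  shows "1 + 2 * theta_half t = (1 + 2 * theta_half (1 / t)) / sqrt t"
proof -
  define g where "g = (\<lambda>z. gaussian t z + (\<Sum>n. gaussian_pair t n z))"
  define gM where "gM = (\<lambda>M z. gaussian t z + (\<Sum>n<M. gaussian_pair t n z))"
  have ul: "uniform_limit (cball 0 R) gM g sequentially" for R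
    unfolding gM_def g_def by (rule gaussian_pair_uniform_limit[OF t])
  have gM_hol: "gM M holomorphic_on UNIV" for M
    unfolding gM_def gaussian_pair_def by (intro holomorphic_intros)
  have g: "g holomorphic_on UNIV"
  proof (rule holomorphic_uniform_sequence[OF open_UNIV gM_hol])
    fix z :: complex
    have "cball z 1 \<subseteq> cball 0 (cmod z + 1)"
    proof
      fix w assume "w \<in> cball z 1"
      then show "w \<in> cball 0 (cmod z + 1)" using norm_triangle_ineq2[of w z] by (simp add: dist_norm norm_minus_commute)
    qed
    then show "\<exists>d>0. cball z d \<subseteq> UNIV \<and> uniform_limit (cball z d) gM g sequentially"
      using uniform_limit_on_subset[OF ul] zero_less_one by blast
  qed
  \<comment> \<open>Uniform convergence on the period interval allows the coefficients of
    \<open>gM M\<close> to pass to the limit, while unfolding shows that they converge to the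
    integral over the whole line.\<close>
  have coeff: "integral {-1/2..1/2} (\<lambda>u. g (of_real u) * fourier_char k (of_real u)) = of_real (exp (- (pi * of_int k ^ 2 / t)) / sqrt t)" for k
  proof -
    have "uniform_limit {-1/2..1/2} (\<lambda>M u. gM M (of_real u)) (\<lambda>u. g (of_real u)) sequentially"
      by (rule uniform_limit_compose'[OF ul[of 1]]) auto
    then have "uniform_limit {-1/2..1/2} (\<lambda>M u. gM M (of_real u) * fourier_char k (of_real u)) (\<lambda>u. g (of_real u) * fourier_char k (of_real u)) sequentially"
      by (intro uniform_limitI) (auto dest!: uniform_limitD simp: dist_norm norm_mult left_diff_distrib[symmetric])
    then obtain I J where IJ: "\<And>M. ((\<lambda>u. gM M (of_real u) * fourier_char k (of_real u)) has_integral I M) {-1/2..1/2}"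
      "((\<lambda>u. g (of_real u) * fourier_char k (of_real u)) has_integral J) {-1/2..1/2}" "I \<longlonglongrightarrow> J"
      by (rule uniform_limit_integral)
         (auto intro!: continuous_intros continuous_on_compose2[OF holomorphic_on_imp_continuous_on[OF gM_hol]])
    have "I M = integral {- (real M + 1/2)..real M + 1/2} (\<lambda>u. gaussian t (of_real u) * fourier_char k (of_real u))" for M
      using has_integral_unique[OF IJ(1)[of M]] gaussian_periodization_fourier[of t M k] unfolding gM_def by blast
    then have "J = of_real (exp (- (pi * of_int k ^ 2 / t)) / sqrt t)"
      using LIMSEQ_unique[OF IJ(3)] gaussian_fourier_tendsto[OF t, of k] by presburger
    then show ?thesis using IJ(2) by (simp add: integral_unique)
  qed
  have "(\<lambda>N. \<Sum>k = - int N..int N. complex_of_real (exp (- (pi * of_int k ^ 2 / t)) / sqrt t)) \<longlonglongrightarrow> g 0"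
    using fourier_symmetric_sums_tendsto[OF g] unfolding coeff .
  moreover have "(\<Sum>k = - int N..int N. complex_of_real (exp (- (pi * of_int k ^ 2 / t)) / sqrt t)) =
     of_real ((1 + 2 * (\<Sum>n<N. exp (- (pi * (1 / t) * real (Suc n) ^ 2)))) / sqrt t)" for N
  proof -
    define v where "v k = exp (- (pi * of_int k ^ 2 / t)) / sqrt t" for k :: int
    have "(\<Sum>k = - int N..int N. v k) = (1 + 2 * (\<Sum>n<N. exp (- (pi * (1 / t) * real (Suc n) ^ 2)))) / sqrt t"
    proof (induction N)
      case 0
      then show ?case by (simp add: v_def)
    next
      case (Suc N)
      have eq: "{- int (Suc N)..int (Suc N)} = insert (- int (Suc N)) (insert (int (Suc N)) {- int N..int N})" by auto
      have "v (- int (Suc N)) = v (int (Suc N))"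
        "v (int (Suc N)) = exp (- (pi * (1 / t) * real (Suc N) ^ 2)) / sqrt t"
        unfolding v_def by (simp_all del: of_nat_Suc)
      then show ?case unfolding eq
        by (simp add: Suc add_divide_distrib del: of_nat_Suc)
    qed
    then show ?thesis unfolding v_def of_real_sum[symmetric] by simp
  qed
  moreover have "(\<lambda>N. complex_of_real ((1 + 2 * (\<Sum>n<N. exp (- (pi * (1 / t) * real (Suc n) ^ 2)))) / sqrt t))
     \<longlonglongrightarrow> of_real ((1 + 2 * theta_half (1 / t)) / sqrt t)"
    unfolding theta_half_def using t
    by (intro tendsto_intros summable_LIMSEQ theta_half_summable) auto
  ultimately have "g 0 = of_real ((1 + 2 * theta_half (1 / t)) / sqrt t)"
    using LIMSEQ_unique by fastforce
  moreover have "g 0 = of_real (1 + 2 * theta_half t)"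
  proof -
    have "gaussian_pair t n 0 = 2 * of_real (exp (- (pi * t * real (Suc n) ^ 2)))" for n
      unfolding gaussian_pair_def gaussian_def exp_of_real[symmetric] by (simp del: of_nat_Suc)
    moreover have "gaussian t 0 = 1" by (simp add: gaussian_def)
    moreover have "(\<lambda>n. complex_of_real (exp (- (pi * t * real (Suc n) ^ 2)))) sums of_real (theta_half t)"
      unfolding theta_half_def using summable_sums[OF theta_half_summable[OF t]] by (rule sums_of_real)
    from sums_mult[OF this, of 2] have "(\<Sum>n. 2 * complex_of_real (exp (- (pi * t * real (Suc n) ^ 2)))) = 2 * of_real (theta_half t)"
      by (rule sums_unique[symmetric])
    ultimately show ?thesis unfolding g_def by simp
  qed
  ultimately show ?thesis by (metis of_real_eq_iff)
qed

section \<open>Series of incomplete Gamma functions\<close>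

definition sector :: "complex set" where
  "sector = {x. Re x > \<bar>Im x\<bar>}"

text \<open>As an integral this is that of
  \<open>u powr (s / 2 - 1) * exp (- r\<^sup>2 * pi * u)\<close> from \<open>x\<^sup>2\<close> on,
  for positive real \<open>x\<close> and \<open>r\<close>. The index \<open>r\<close> is real
  because \<open>Upsilon\<close> uses half-integers.\<close>

definition Gamma_upper_term :: "real \<Rightarrow> complex \<Rightarrow> complex \<Rightarrow> complex" where
  "Gamma_upper_term r x s = Gamma_upper (s / 2) (of_real (r\<^sup>2 * pi) * x\<^sup>2) / of_real (r\<^sup>2 * pi) powr (s / 2)"

definition Gamma_upper_series :: "complex \<Rightarrow> complex \<Rightarrow> complex" where
  "Gamma_upper_series x s = (\<Sum>k. Gamma_upper_term (real (Suc k)) x s)"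

section \<open>Geometry of the sector\<close>

lemma sector_open: "open sector"
proof -
  have eq: "sector = {x. Re x > Im x} \<inter> {x. Re x > - Im x}" by (auto simp: sector_def)
  show ?thesis unfolding eq by (intro open_Int open_Collect_less continuous_intros)
qed

lemma sector_convex: "convex sector"
proof -
  have eq: "sector = {x. inner (Complex (-1) 1) x < 0} \<inter> {x. inner (Complex (-1) (-1)) x < 0}"
    by (auto simp: sector_def inner_complex_def)
  show ?thesis unfolding eq by (intro convex_Int convex_halfspace_lt)
qed

lemma sectorD:
  assumes "x \<in> sector"
  shows "Re (x\<^sup>2) > 0" "Re x > 0" "x \<noteq> 0" "x \<notin> \<real>\<^sub>\<le>\<^sub>0"
proof -
  have "\<bar>Im x\<bar>^2 < Re x ^2"
    using assms by (intro power_strict_mono) (auto simp: sector_def)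
  then show "Re (x\<^sup>2) > 0" by (simp add: Re_power2)
  show "Re x > 0" using assms by (auto simp: sector_def)
  then show "x \<noteq> 0" "x \<notin> \<real>\<^sub>\<le>\<^sub>0" by (auto simp: complex_nonpos_Reals_iff)
qed

lemma sector_of_real: "y > 0 \<Longrightarrow> of_real y \<in> sector"
  by (simp add: sector_def)

lemma sector_scale: "x \<in> sector \<Longrightarrow> c > 0 \<Longrightarrow> of_real c * x \<in> sector"
  by (simp add: sector_def abs_mult)

lemma sector_inverse:
  assumes "x \<in> sector"
  shows "1 / x \<in> sector"
proof -
  have "(Re x)^2 + (Im x)^2 > 0" using sectorD[OF assms] by (simp add: sum_power2_gt_zero_iff)
  then show ?thesis using assms
    by (simp add: sector_def Re_divide Im_divide divide_strict_right_mono)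
qed

text \<open>With \<open>p = r\<^sup>2 * pi\<close>, the incomplete Gamma factor decays at rate
  \<open>p * Re (x\<^sup>2) / 2\<close>, and the power of \<open>p\<close> costs at most a quarter
  of this, since \<open>\<delta> / 8 * p \<le> p * Re (x\<^sup>2) / 8\<close>. The remaining 3/8,
  with \<open>p \<ge> 3 * r\<^sup>2\<close>, exceeds the stated rate.\<close>

lemma Gamma_upper_term_bound:
  fixes \<delta> K R :: real
  assumes "\<delta> > 0" "K \<ge> 1"
  obtains C where "C > 0"
    "\<And>s x r. \<lbrakk>cmod s \<le> R; Re (x\<^sup>2) \<ge> \<delta>; cmod (x\<^sup>2) \<le> K * Re (x\<^sup>2); r \<ge> 1\<rbrakk> \<Longrightarrow>
      cmod (Gamma_upper_term r x s) \<le> C * exp (- (r\<^sup>2 * Re (x\<^sup>2)))"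
proof -
  obtain C1 where C1: "C1 > 0"
    "\<And>a z. \<lbrakk>cmod a \<le> R; Re z \<ge> \<delta>; cmod z \<le> K * Re z\<rbrakk> \<Longrightarrow> cmod (Gamma_upper a z) \<le> C1 * exp (- Re z / 2)"
    by (rule Gamma_upper_bound[OF assms, of R]) blast
  obtain C2 where C2: "C2 > 0"
    "\<And>b w. \<lbrakk>cmod b \<le> R; Re w \<ge> 1; cmod w \<le> 1 * Re w\<rbrakk> \<Longrightarrow> cmod (w powr b) \<le> C2 * exp (\<delta> / 8 * Re w)"
    by (rule norm_powr_le_exp[of 1 "\<delta>/8" R 1]) (use assms in auto)
  have "cmod (Gamma_upper_term r x s) \<le> (C1 * C2) * exp (- (r\<^sup>2 * Re (x\<^sup>2)))"
    if s: "cmod s \<le> R" and x: "Re (x\<^sup>2) \<ge> \<delta>" "cmod (x\<^sup>2) \<le> K * Re (x\<^sup>2)" and r: "r \<ge> 1" for s x r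
  proof -
    define p where "p = r\<^sup>2 * pi"
    define X where "X = x\<^sup>2"
    have r2: "r\<^sup>2 \<ge> 1" using r by simp
    then have "r\<^sup>2 * 3 \<le> p" unfolding p_def using pi_gt3 by (intro mult_left_mono) auto
    then have p: "p \<ge> 1" "p \<ge> 3 * r\<^sup>2" using r2 by auto
    have s2: "cmod (s / 2) \<le> R" "cmod (- (s / 2)) \<le> R" using s order_trans[OF norm_ge_zero s] by (simp_all add: norm_divide)
    have "p * Re X \<ge> 1 * \<delta>" using p x assms unfolding X_def by (intro mult_mono) auto
    moreover have "cmod (of_real p * X) \<le> K * Re (of_real p * X)"
      using mult_left_mono[OF x(2), of p] p by (simp add: norm_mult X_def mult_ac)
    ultimately have g: "cmod (Gamma_upper (s / 2) (of_real p * X)) \<le> C1 * exp (- (p * Re X) / 2)"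
      using C1(2)[OF s2(1), of "of_real p * X"] by simp
    have "cmod (of_real p powr (- (s / 2))) \<le> C2 * exp (\<delta> / 8 * p)"
      using C2(2)[OF s2(2), of "of_real p"] p by simp
    then have "cmod (Gamma_upper_term r x s) \<le> (C1 * exp (- (p * Re X) / 2)) * (C2 * exp (\<delta> / 8 * p))"
      unfolding Gamma_upper_term_def p_def[symmetric] X_def[symmetric] powr_minus_divide divide_inverse norm_mult
      using g C1(1) by (intro mult_mono) (auto simp: powr_minus norm_inverse)
    also have "\<dots> = (C1 * C2) * exp (- (p * Re X) / 2 + \<delta> / 8 * p)"
      unfolding exp_add by (simp only: mult_ac)
    also have "\<dots> \<le> (C1 * C2) * exp (- (r\<^sup>2 * Re X))"
    proof -
      have "\<delta> * p \<le> Re X * p" using x p unfolding X_def by (intro mult_right_mono) auto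
      moreover have "3 * r\<^sup>2 * Re X \<le> p * Re X" using p x assms unfolding X_def by (intro mult_right_mono) auto
      moreover have "r\<^sup>2 * Re X \<ge> 0" using x assms unfolding X_def by simp
      ultimately have "- (p * Re X) / 2 + \<delta> / 8 * p \<le> - (r\<^sup>2 * Re X)" by (simp add: mult_ac)
      then show ?thesis using C1 C2 by (intro mult_left_mono) auto
    qed
    finally show ?thesis unfolding X_def .
  qed
  moreover have "C1 * C2 > 0" using C1 C2 by simp
  ultimately show ?thesis using that by blast
qed

text \<open>A single majorant covers both variables, so it serves for holomorphy in \<open>s\<close>
  as well as for differentiation in \<open>x\<close>.\<close>

lemma Gamma_upper_term_summable_bound:
  fixes \<delta> K R :: real
  assumes "\<delta> > 0" "K \<ge> 1"
  obtains h where "summable h"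
    "\<And>s x k. \<lbrakk>cmod s \<le> R; Re (x\<^sup>2) \<ge> \<delta>; cmod (x\<^sup>2) \<le> K * Re (x\<^sup>2)\<rbrakk> \<Longrightarrow>
      cmod (Gamma_upper_term (real (Suc k)) x s) \<le> h k"
proof -
  obtain C where C: "C > 0"
    "\<And>s x r. \<lbrakk>cmod s \<le> R; Re (x\<^sup>2) \<ge> \<delta>; cmod (x\<^sup>2) \<le> K * Re (x\<^sup>2); r \<ge> 1\<rbrakk> \<Longrightarrow>
      cmod (Gamma_upper_term r x s) \<le> C * exp (- (r\<^sup>2 * Re (x\<^sup>2)))"
    by (rule Gamma_upper_term_bound[OF assms, of R]) blast
  have "cmod (Gamma_upper_term (real (Suc k)) x s) \<le> C * exp (- \<delta>) ^ Suc k"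
    if "cmod s \<le> R" "Re (x\<^sup>2) \<ge> \<delta>" "cmod (x\<^sup>2) \<le> K * Re (x\<^sup>2)" for s x k
  proof -
    have "real (Suc k) * 1 \<le> real (Suc k) * real (Suc k)" by (intro mult_left_mono) auto
    then have "real (Suc k) * \<delta> \<le> (real (Suc k))\<^sup>2 * Re (x\<^sup>2)"
      using that assms by (intro mult_mono) (auto simp: power2_eq_square)
    then have "exp (- ((real (Suc k))\<^sup>2 * Re (x\<^sup>2))) \<le> exp (- \<delta>) ^ Suc k"
      by (simp add: exp_of_nat_mult[symmetric] del: of_nat_Suc power_Suc)
    then have "C * exp (- ((real (Suc k))\<^sup>2 * Re (x\<^sup>2))) \<le> C * exp (- \<delta>) ^ Suc k"
      using C(1) by (intro mult_left_mono) auto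
    then show ?thesis using C(2)[OF that, of "real (Suc k)"] by (simp del: of_nat_Suc power_Suc)
  qed
  moreover have "summable (\<lambda>k. C * exp (- \<delta>) ^ Suc k)"
    using assms by (intro summable_mult) (simp add: summable_geometric)
  ultimately show ?thesis using that by blast
qed

lemma Gamma_upper_term_locally_bounded:
  assumes "compact S" "S \<subseteq> sector"
  obtains h where "summable h" "\<And>s x k. \<lbrakk>cmod s \<le> R; x \<in> S\<rbrakk> \<Longrightarrow> cmod (Gamma_upper_term (real (Suc k)) x s) \<le> h k"
proof -
  have c: "compact ((\<lambda>x. x\<^sup>2) ` S)" using assms by (intro compact_continuous_image continuous_intros)
  have p: "Re z > 0" if "z \<in> (\<lambda>x. x\<^sup>2) ` S" for z using that assms sectorD by blast
  obtain \<delta> K where dK: "\<delta> > 0" "K \<ge> 1" "\<And>z. z \<in> (\<lambda>x. x\<^sup>2) ` S \<Longrightarrow> Re z \<ge> \<delta> \<and> cmod z \<le> K * Re z"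
    using Re_pos_compact_bounds[OF c p] by metis
  obtain h where h: "summable h"
    "\<And>s x k. \<lbrakk>cmod s \<le> R; Re (x\<^sup>2) \<ge> \<delta>; cmod (x\<^sup>2) \<le> K * Re (x\<^sup>2)\<rbrakk> \<Longrightarrow>
      cmod (Gamma_upper_term (real (Suc k)) x s) \<le> h k"
    by (rule Gamma_upper_term_summable_bound[OF dK(1,2), of R]) blast
  show ?thesis
    by (rule that[OF h(1)], rule h(2)) (use dK(3) in auto)
qed

lemma Gamma_upper_term_sums:
  assumes "x \<in> sector"
  shows "(\<lambda>k. Gamma_upper_term (real (Suc k)) x s) sums Gamma_upper_series x s"
proof -
  have c: "compact {x}" by simp
  obtain h where h: "summable h" "\<And>k. cmod (Gamma_upper_term (real (Suc k)) x s) \<le> h k"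
    by (rule Gamma_upper_term_locally_bounded[OF c, of "cmod s"]) (use assms in auto)
  have "summable (\<lambda>k. Gamma_upper_term (real (Suc k)) x s)"
    by (rule summable_comparison_test'[OF h(1), of 0]) (use h(2) in auto)
  then show ?thesis unfolding Gamma_upper_series_def by (rule summable_sums)
qed

lemma Gamma_upper_series_holomorphic:
  assumes "x \<in> sector"
  shows "Gamma_upper_series x holomorphic_on UNIV"
proof (rule holomorphic_uniform_sequence[where f = "\<lambda>n s. \<Sum>k<n. Gamma_upper_term (real (Suc k)) x s"])
  have "Gamma_upper_term r x holomorphic_on UNIV" if "r > 0" for r
  proof -
    have "Re (of_real (r\<^sup>2 * pi) * x\<^sup>2) > 0" using sectorD[OF assms] that by simp
    from holomorphic_on_compose[OF _ holomorphic_on_subset[OF Gamma_upper_holomorphic[OF this]], of "\<lambda>s. s / 2" UNIV]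
    have "(\<lambda>s. Gamma_upper (s / 2) (of_real (r\<^sup>2 * pi) * x\<^sup>2)) holomorphic_on UNIV"
      unfolding o_def by (simp add: holomorphic_on_divide)
    then show ?thesis unfolding Gamma_upper_term_def using that by (intro holomorphic_intros) auto
  qed
  then show "(\<lambda>s. \<Sum>k<n. Gamma_upper_term (real (Suc k)) x s) holomorphic_on UNIV" for n
    by (intro holomorphic_intros) auto
  fix s0 :: complex
  have c: "compact {x}" by simp
  obtain h where h: "summable h" "\<And>s k. cmod s \<le> cmod s0 + 1 \<Longrightarrow> cmod (Gamma_upper_term (real (Suc k)) x s) \<le> h k"
    by (rule Gamma_upper_term_locally_bounded[OF c, of "cmod s0 + 1"]) (use assms in auto)
  have "uniform_limit (cball s0 1) (\<lambda>n s. \<Sum>k<n. Gamma_upper_term (real (Suc k)) x s) (Gamma_upper_series x) sequentially"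
    unfolding Gamma_upper_series_def
  proof (rule Weierstrass_m_test[OF _ h(1)])
    fix n s assume "s \<in> cball s0 1"
    then have "cmod s \<le> cmod s0 + 1" using norm_triangle_ineq2[of s s0] by (auto simp: dist_norm norm_minus_commute)
    then show "cmod (Gamma_upper_term (real (Suc n)) x s) \<le> h n" by (rule h(2))
  qed
  then show "\<exists>d>0. cball s0 d \<subseteq> UNIV \<and> uniform_limit (cball s0 d) (\<lambda>n s. \<Sum>k<n. Gamma_upper_term (real (Suc k)) x s) (Gamma_upper_series x) sequentially"
    using zero_less_one by blast
qed auto

text \<open>The argument of \<open>x\<close> is below \<open>pi / 2\<close> in absolute value, so
  doubling it does not leave the principal branch.\<close>

lemma square_powr:
  assumes "Re x > 0"
  shows "(x\<^sup>2) powr b = x powr (2 * b)"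
proof -
  have x: "x \<noteq> 0" using assms by auto
  have "\<bar>Im (Ln x)\<bar> < pi / 2" using assms by (rule Re_Ln_pos_lt_imp)
  then have "Ln (x\<^sup>2) = 2 * Ln x"
    using x by (intro Ln_unique) (auto simp: power2_eq_square exp_double)
  then show ?thesis using x by (simp add: powr_def mult_ac)
qed

text \<open>The powers of \<open>r\<^sup>2 * pi\<close> from the chain rule cancel against the
  denominator, so that \<open>r\<close> survives only in the exponential. This is why the
  differentiated series is a theta series.\<close>

lemma Gamma_upper_term_has_field_derivative:
  assumes x: "x \<in> sector" and r: "r > 0"
  shows "((\<lambda>x. Gamma_upper_term r x s) has_field_derivative
    - 2 * x powr (s - 1) * exp (- (of_real (r\<^sup>2 * pi) * x\<^sup>2))) (at x)"
proof -
  define p where "p = complex_of_real (r\<^sup>2 * pi)"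
  have p: "p \<in> \<real>" "Re p > 0" "p \<noteq> 0" using r by (auto simp: p_def)
  have "Re (p * x\<^sup>2) > 0" using sectorD[OF x] r by (simp add: p_def)
  note G = Gamma_upper_has_field_derivative[OF this, of "s / 2"]
  have "((\<lambda>x. Gamma_upper (s / 2) (p * x\<^sup>2) / p powr (s / 2)) has_field_derivative
     - ((p * x\<^sup>2) powr (s / 2 - 1) * exp (- (p * x\<^sup>2))) * (p * (2 * x)) / p powr (s / 2)) (at x)"
    by (intro DERIV_cdivide DERIV_chain2[where f = "Gamma_upper (s / 2)" and g = "\<lambda>x. p * x\<^sup>2" and x = x, OF G]) (auto intro!: derivative_eq_intros)
  moreover have "- ((p * x\<^sup>2) powr (s / 2 - 1) * exp (- (p * x\<^sup>2))) * (p * (2 * x)) / p powr (s / 2)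
     = - 2 * x powr (s - 1) * exp (- (p * x\<^sup>2))"
  proof -
    have "(p * x\<^sup>2) powr (s / 2 - 1) = p powr (s / 2 - 1) * (x\<^sup>2) powr (s / 2 - 1)"
      using p by (intro powr_times_real_left) auto
    also have "(x\<^sup>2) powr (s / 2 - 1) = x powr (s - 2)"
      using square_powr[of x "s/2 - 1"] sectorD[OF x] by (simp add: algebra_simps)
    finally have e: "(p * x\<^sup>2) powr (s / 2 - 1) = p powr (s / 2 - 1) * x powr (s - 2)" .
    have e1: "p powr (s / 2) = p powr (s / 2 - 1) * p"
      using p by (simp add: powr_diff)
    have "x powr (s - 1) = x powr ((s - 2) + 1)" by simp
    also have "\<dots> = x powr (s - 2) * x" using sectorD[OF x] by (subst powr_add) simp
    finally have e2: "x powr (s - 1) = x powr (s - 2) * x" .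
    show ?thesis unfolding e e1 e2 using p by (simp add: field_simps)
  qed
  ultimately show ?thesis unfolding Gamma_upper_term_def p_def by simp
qed

text \<open>The derivative exists on the whole sector but is made explicit only on the positive
  axis, where the real function \<open>theta_half\<close> is available.\<close>

lemma Gamma_upper_series_derivative:
  obtains D where
    "\<And>x. x \<in> sector \<Longrightarrow> ((\<lambda>x. Gamma_upper_series x s) has_field_derivative D x) (at x)"
    "\<And>y. y > 0 \<Longrightarrow> D (of_real y) = - 2 * of_real y powr (s - 1) * of_real (theta_half (y\<^sup>2))"
proof -
  define f' where "f' = (\<lambda>k x. - 2 * x powr (s - 1) * exp (- (of_real ((real (Suc k))\<^sup>2 * pi) * x\<^sup>2)))"
  \<comment> \<open>A local majorant for the terms themselves suffices: for holomorphic functions,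
    locally uniform convergence passes to the derivatives.\<close>
  have "\<exists>g g'. \<forall>x\<in>sector. (\<lambda>k. Gamma_upper_term (real (Suc k)) x s) sums g x \<and> (\<lambda>k. f' k x) sums g' x \<and> (g has_field_derivative g' x) (at x)"
  proof (rule series_and_derivative_comparison_local[OF sector_open])
    show "((\<lambda>x. Gamma_upper_term (real (Suc k)) x s) has_field_derivative f' k x) (at x)" if "x \<in> sector" for k x
      unfolding f'_def using Gamma_upper_term_has_field_derivative[OF that, of "real (Suc k)"] by simp
    fix x assume "x \<in> sector"
    then obtain d where d: "d > 0" "cball x d \<subseteq> sector" using sector_open open_contains_cball by blast
    obtain h where h: "summable h" "\<And>y k. y \<in> cball x d \<Longrightarrow> cmod (Gamma_upper_term (real (Suc k)) y s) \<le> h k"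
      by (rule Gamma_upper_term_locally_bounded[OF compact_cball d(2), of "cmod s"]) auto
    have "\<forall>\<^sub>F n in sequentially. \<forall>y\<in>ball x d \<inter> sector. cmod (Gamma_upper_term (real (Suc n)) y s) \<le> h n"
      by (intro always_eventually allI ballI h(2)) (simp add: less_imp_le)
    then show "\<exists>d h. 0 < d \<and> summable h \<and> (\<forall>\<^sub>F n in sequentially. \<forall>y\<in>ball x d \<inter> sector. cmod (Gamma_upper_term (real (Suc n)) y s) \<le> h n)"
      using d(1) h(1) by (intro exI[of _ d] exI[of _ h] conjI)
  qed
  then obtain g D where "\<forall>x\<in>sector. (\<lambda>k. Gamma_upper_term (real (Suc k)) x s) sums g x \<and> (\<lambda>k. f' k x) sums D x \<and> (g has_field_derivative D x) (at x)"
    by (elim exE)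
  then have gD: "\<And>x. x \<in> sector \<Longrightarrow> (\<lambda>k. Gamma_upper_term (real (Suc k)) x s) sums g x"
    "\<And>x. x \<in> sector \<Longrightarrow> (\<lambda>k. f' k x) sums D x"
    "\<And>x. x \<in> sector \<Longrightarrow> (g has_field_derivative D x) (at x)" by auto
  have g: "g x = Gamma_upper_series x s" if "x \<in> sector" for x
    using sums_unique2[OF gD(1)[OF that] Gamma_upper_term_sums[OF that]] .
  show ?thesis
  proof (rule that)
    fix x assume x: "x \<in> sector"
    show "((\<lambda>x. Gamma_upper_series x s) has_field_derivative D x) (at x)"
      by (rule has_field_derivative_transform_within_open[OF gD(3)[OF x] sector_open x]) (rule g)
  next
    fix y :: real assume y: "y > 0"
    have "(\<lambda>k. exp (- (pi * y\<^sup>2 * real (Suc k) ^ 2))) sums theta_half (y\<^sup>2)"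
      unfolding theta_half_def using y by (intro summable_sums theta_half_summable) auto
    from sums_mult[OF sums_of_real[OF this], of "- 2 * of_real y powr (s - 1)"]
    have "(\<lambda>k. f' k (of_real y)) sums (- 2 * of_real y powr (s - 1) * of_real (theta_half (y\<^sup>2)))"
      unfolding f'_def exp_of_real[symmetric] by (simp add: mult_ac del: of_nat_Suc)
    then show "D (of_real y) = - 2 * of_real y powr (s - 1) * of_real (theta_half (y\<^sup>2))"
      using sums_unique2[OF gD(2)[OF sector_of_real[OF y]]] by blast
  qed
qed

section \<open>The completed zeta function\<close>

text \<open>Twice Riemann's xi function, in the form obtained by cutting the Mellin integral of the
  theta series at \<open>x\<^sup>2\<close>.\<close>

definition split_xi :: "complex \<Rightarrow> complex \<Rightarrow> complex" where
  "split_xi x s = (1 - s) * x powr s + s * x powr (s - 1)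
     + s * (s - 1) * (Gamma_upper_series x s + Gamma_upper_series (1 / x) (1 - s))"

lemma split_xi_indep:
  assumes x: "x \<in> sector"
  shows "split_xi x s = split_xi 1 s"
proof -
  obtain D1 where D1: "\<And>x. x \<in> sector \<Longrightarrow> ((\<lambda>x. Gamma_upper_series x s) has_field_derivative D1 x) (at x)"
    "\<And>y. y > 0 \<Longrightarrow> D1 (of_real y) = - 2 * of_real y powr (s - 1) * of_real (theta_half (y\<^sup>2))"
    using Gamma_upper_series_derivative[of s] by metis
  obtain D2 where D2: "\<And>x. x \<in> sector \<Longrightarrow> ((\<lambda>x. Gamma_upper_series x (1 - s)) has_field_derivative D2 x) (at x)"
    "\<And>y. y > 0 \<Longrightarrow> D2 (of_real y) = - 2 * of_real y powr ((1 - s) - 1) * of_real (theta_half (y\<^sup>2))"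
    using Gamma_upper_series_derivative[of "1 - s"] by metis
  define H where "H = (\<lambda>x. split_xi x s)"
  define H' where "H' = (\<lambda>x. (1 - s) * (s * x powr (s - 1)) + s * ((s - 1) * x powr (s - 1 - 1))
     + s * (s - 1) * (D1 x + D2 (1 / x) * (- 1 / x\<^sup>2)))"
  have dH: "(H has_field_derivative H' x) (at x)" if "x \<in> sector" for x
  proof -
    have inv: "((\<lambda>x. 1 / x) has_field_derivative - 1 / x\<^sup>2) (at x)"
      using sectorD(3)[OF that] by (auto intro!: derivative_eq_intros simp: power2_eq_square)
    note DERIV_chain2[OF D2(1)[OF sector_inverse[OF that]] inv]
    then show ?thesis
      unfolding H_def H'_def split_xi_def
      by (intro DERIV_add DERIV_cmult has_field_derivative_powr D1(1) that sectorD(4))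
  qed
  have H'0: "H' (of_real y) = 0" if y: "y > 0" for y
  proof -
    define P where "P = complex_of_real y powr (s - 2)"
    have "complex_of_real y powr (s - 1) = complex_of_real y powr ((s - 2) + 1)" by simp
    also have "\<dots> = P * of_real y" unfolding P_def using y by (subst powr_add) simp
    finally have e1: "complex_of_real y powr (s - 1) = P * of_real y" .
    have "complex_of_real (1 / y) powr ((1 - s) - 1) = complex_of_real y powr s"
    proof -
      have "Ln (complex_of_real (1 / y)) = of_real (ln (1 / y))" using y by (intro Ln_of_real) simp
      also have "\<dots> = - Ln (of_real y)" using y by (simp add: ln_div Ln_of_real)
      finally show ?thesis using y by (simp add: powr_def)
    qed
    also have "\<dots> = complex_of_real y powr ((s - 2) + of_nat 2)" by simp
    also have "\<dots> = P * of_real y ^ 2" unfolding P_def using y by (subst powr_add, subst powr_complexpow) auto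
    finally have e2: "complex_of_real (1 / y) powr ((1 - s) - 1) = P * of_real y ^ 2" .
    have e3: "complex_of_real y powr (s - 1 - 1) = P" by (simp add: P_def)
    define a b where "a = theta_half (y\<^sup>2)" and "b = theta_half (1 / y\<^sup>2)"
    have "1 + 2 * a = (1 + 2 * b) / y"
      using theta_half_functional_equation[of "y\<^sup>2"] y by (simp add: a_def b_def)
    then have "2 * b = y * (1 + 2 * a) - 1" using y by (simp add: field_simps)
    then have "complex_of_real (2 * b) = of_real (y * (1 + 2 * a) - 1)" by (rule arg_cong)
    \<comment> \<open>The theta equation solved for the value at \<open>1 / y\<^sup>2\<close>. Once
      it is inserted, \<open>H'\<close> contains only \<open>P\<close>, \<open>P * y\<close> and
      \<open>P * y * a\<close>, whose coefficients all vanish.\<close>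
    then have b: "2 * complex_of_real b = of_real y * (1 + 2 * of_real a) - 1" by simp
    have d1: "D1 (of_real y) = - 2 * (P * of_real y) * of_real a"
      using D1(2)[OF y] unfolding e1 a_def by simp
    have "D2 (of_real (1 / y)) = - 2 * (P * of_real y ^ 2) * of_real b"
      using D2(2)[of "1 / y"] y unfolding e2 b_def by (simp add: power_divide)
    then have d2: "D2 (1 / of_real y) = - 2 * (P * of_real y ^ 2) * of_real b" by simp
    have d3: "D2 (1 / of_real y) * (- 1 / of_real y ^ 2) = P * (2 * of_real b)"
      unfolding d2 using y by simp
    show ?thesis unfolding H'_def e1 e3 d1 d3 b by (simp add: algebra_simps)
  qed
  have H_hol: "H holomorphic_on sector"
    using dH by (auto simp: holomorphic_on_open[OF sector_open])
  \<comment> \<open>The identity theorem is applied to \<open>deriv H\<close>; a vanishing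
    derivative then gives constancy because the sector is convex.\<close>
  have dd: "deriv H x = 0" if "x \<in> sector" for x
  proof (rule analytic_continuation[where f = "deriv H" and S = sector and U = "of_real ` {0<..}" and \<xi> = 1])
    show "deriv H holomorphic_on sector" by (rule holomorphic_deriv[OF H_hol sector_open])
    show "connected sector" by (rule convex_connected[OF sector_convex])
    show "complex_of_real ` {0<..} \<subseteq> sector" using sector_of_real by auto
    show "(1::complex) \<in> sector" by (simp add: sector_def)
    show "(1::complex) islimpt of_real ` {0<..}"
      unfolding islimpt_sequential
    proof (intro exI conjI allI)
      define X where "X = (\<lambda>n. 1 + 1 / real (Suc n))"
      have "X n > 0" "X n \<noteq> 1" for n unfolding X_def by (simp_all add: add_pos_pos)
      then show "complex_of_real (X n) \<in> of_real ` {0<..} - {1}" for n by simp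
      have "X \<longlonglongrightarrow> 1" unfolding X_def by real_asymp
      then show "(\<lambda>n. complex_of_real (X n)) \<longlonglongrightarrow> 1"
        using tendsto_of_real[of X 1 sequentially] by simp
    qed
    show "deriv H z = 0" if "z \<in> of_real ` {0<..}" for z
      using that H'0 DERIV_imp_deriv[OF dH] sector_of_real by auto
  qed (use sector_open that in auto)
  have "(H has_field_derivative 0) (at x within sector)" if "x \<in> sector" for x
  proof -
    have "H' x = 0" by (rule trans[OF sym[OF DERIV_imp_deriv[OF dH[OF that]]] dd[OF that]])
    then show ?thesis using has_field_derivative_at_within[OF dH[OF that], of sector] by (simp only:)
  qed
  then obtain c where "\<forall>x\<in>sector. H x = c"
    using has_field_derivative_zero_constant[OF sector_convex, of H] by blast
  moreover have "1 \<in> sector" by (simp add: sector_def)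
  ultimately show ?thesis using x unfolding H_def by metis
qed

lemma split_xi_holomorphic: "split_xi 1 holomorphic_on UNIV"
proof -
  have 1: "1 \<in> sector" by (simp add: sector_def)
  have "(\<lambda>s. Gamma_upper_series 1 (1 - s)) holomorphic_on UNIV"
    using holomorphic_on_compose[OF _ holomorphic_on_subset[OF Gamma_upper_series_holomorphic[OF 1]], of "\<lambda>s. 1 - s" UNIV]
    unfolding o_def by (simp add: holomorphic_on_diff)
  then show ?thesis
    unfolding split_xi_def using Gamma_upper_series_holomorphic[OF 1] by (auto intro!: holomorphic_intros)
qed

section \<open>The split point tending to 0\<close>

lemma tendsto_suminf_dominated:
  fixes a :: "nat \<Rightarrow> 'b \<Rightarrow> 'a :: {real_normed_algebra, banach}"
  assumes "\<And>k. ((\<lambda>n. a k n) \<longlongrightarrow> b k) F" "summable M" "F \<noteq> bot"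
    "\<forall>\<^sub>F n in F. \<forall>k. norm (a k n) \<le> M k"
  shows "((\<lambda>n. \<Sum>k. a k n) \<longlongrightarrow> suminf b) F"
proof -
  have "eventually (\<lambda>(k,n). norm (a k n) \<le> M k) (at_top \<times>\<^sub>F F)"
    using eventually_prodI[OF eventually_True[of at_top] assms(4)]
    by (rule eventually_mono) auto
  then show ?thesis using tannerys_theorem[of a b F M] assms by blast
qed

lemma real_square_pi_powr:
  assumes "r > 0"
  shows "complex_of_real (r\<^sup>2 * pi) powr (s / 2) = of_real r powr s * of_real pi powr (s / 2)"
proof -
  have "complex_of_real (r\<^sup>2 * pi) powr (s / 2) = (of_real r ^ 2) powr (s / 2) * of_real pi powr (s / 2)"
    using assms by (simp add: powr_times_real)
  also have "(of_real r ^ 2) powr (s / 2) = of_real r powr s"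
    using square_powr[of "of_real r" "s / 2"] assms by simp
  finally show ?thesis .
qed

text \<open>Each incomplete Gamma value tends to the complete one, and the uniform bound
  \<open>G\<close> leaves the convergent series of \<open>real (Suc k) powr (- Re s)\<close> as
  majorant.\<close>

lemma Gamma_upper_series_tendsto_small:
  assumes s: "Re s > 1"
  shows "((\<lambda>y. Gamma_upper_series (of_real y) s) \<longlongrightarrow>
    Gamma (s / 2) / of_real pi powr (s / 2) * (\<Sum>n. 1 / of_nat (Suc n) powr s)) (at_right 0)"
proof -
  define \<sigma> where "\<sigma> = Re s"
  obtain G where G: "\<And>y. y > 0 \<Longrightarrow> cmod (Gamma_upper (s / 2) (of_real y)) \<le> G"
    using Gamma_upper_le_real[of "s / 2"] s by auto
  define c where "c = cmod (of_real pi powr (s / 2))"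
  have c: "c > 0" by (simp add: c_def)
  have np: "cmod (of_real (real (Suc k)) powr s) = real (Suc k) powr \<sigma>" for k
    by (subst norm_powr_real_powr) (auto simp: \<sigma>_def)
  have sm: "summable (\<lambda>k. G / c * real (Suc k) powr (- \<sigma>))"
    using s summable_Suc_iff[of "\<lambda>n. real n powr (- \<sigma>)"]
    by (intro summable_mult) (simp add: summable_real_powr_iff \<sigma>_def)
  have "((\<lambda>y. \<Sum>k. Gamma_upper_term (real (Suc k)) (of_real y) s) \<longlongrightarrow>
    (\<Sum>k. Gamma (s / 2) / of_real pi powr (s / 2) * (1 / of_nat (Suc k) powr s))) (at_right 0)"
  proof (rule tendsto_suminf_dominated[OF _ sm])
    fix k
    define r where "r = real (Suc k)"
    have r: "r > 0" by (simp add: r_def)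
    have "filterlim (\<lambda>y. r\<^sup>2 * pi * y\<^sup>2) (at_right 0) (at_right 0)" using r by real_asymp
    from filterlim_compose[OF Gamma_upper_tendsto_Gamma this, of "s / 2"] s
    have "((\<lambda>y. Gamma_upper (s / 2) (of_real (r\<^sup>2 * pi) * of_real y ^ 2)) \<longlongrightarrow> Gamma (s / 2)) (at_right 0)"
      by simp
    from tendsto_divide[OF this tendsto_const[of "of_real (r\<^sup>2 * pi) powr (s / 2)"]] r
    have "((\<lambda>y. Gamma_upper_term r (of_real y) s) \<longlongrightarrow> Gamma (s / 2) / of_real (r\<^sup>2 * pi) powr (s / 2)) (at_right 0)"
      unfolding Gamma_upper_term_def by simp
    then show "((\<lambda>y. Gamma_upper_term (real (Suc k)) (of_real y) s) \<longlongrightarrow> Gamma (s / 2) / of_real pi powr (s / 2) * (1 / of_nat (Suc k) powr s)) (at_right 0)"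
      unfolding real_square_pi_powr[OF r] unfolding r_def by (simp add: mult_ac)
  next
    show "\<forall>\<^sub>F y in at_right 0. \<forall>k. cmod (Gamma_upper_term (real (Suc k)) (of_real y) s) \<le> G / c * real (Suc k) powr (- \<sigma>)"
      using eventually_at_right_less[of "0::real"]
    proof eventually_elim
      case (elim y)
      show ?case
      proof
        fix k
        have "cmod (Gamma_upper_term (real (Suc k)) (of_real y) s) =
          cmod (Gamma_upper (s / 2) (of_real ((real (Suc k))\<^sup>2 * pi * y\<^sup>2))) / (real (Suc k) powr \<sigma> * c)"
          unfolding Gamma_upper_term_def norm_divide
          by (subst real_square_pi_powr) (simp_all add: norm_mult np c_def[symmetric] del: of_nat_Suc of_real_of_nat_eq)
        also have "\<dots> \<le> G / (real (Suc k) powr \<sigma> * c)"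
          using c elim by (intro divide_right_mono G) auto
        also have "\<dots> = G / c * real (Suc k) powr (- \<sigma>)" by (simp add: powr_minus field_simps)
        finally show "cmod (Gamma_upper_term (real (Suc k)) (of_real y) s) \<le> G / c * real (Suc k) powr (- \<sigma>)" .
      qed
    qed
  qed simp
  moreover have "summable (\<lambda>k. 1 / of_nat (Suc k) powr s)"
  proof (rule summable_comparison_test[OF exI[of _ 0]], intro allI impI)
    show "summable (\<lambda>k. real (Suc k) powr (- \<sigma>))"
      using s summable_Suc_iff[of "\<lambda>n. real n powr (- \<sigma>)"] by (simp add: summable_real_powr_iff \<sigma>_def)
    show "cmod (1 / of_nat (Suc k) powr s) \<le> real (Suc k) powr (- \<sigma>)" for k
      using np[of k] by (simp add: norm_divide powr_minus_divide del: of_nat_Suc)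
  qed
  then have "(\<Sum>k. Gamma (s / 2) / of_real pi powr (s / 2) * (1 / of_nat (Suc k) powr s)) =
    Gamma (s / 2) / of_real pi powr (s / 2) * (\<Sum>k. 1 / of_nat (Suc k) powr s)"
    by (rule suminf_mult)
  ultimately show ?thesis unfolding Gamma_upper_series_def by (simp only:)
qed

text \<open>Each term is at most a constant times \<open>exp (- r\<^sup>2 / y\<^sup>2)\<close>. As
  \<open>(1 / y)\<^sup>2\<close> is real, the cone constant can be 1, and the majorant applies once
  \<open>1 / y\<^sup>2 \<ge> 1\<close>.\<close>

lemma Gamma_upper_series_tendsto_large:
  "((\<lambda>y. Gamma_upper_series (1 / of_real y) s) \<longlongrightarrow> 0) (at_right 0)"
proof -
  obtain C where C: "C > 0"
    "\<And>s' x r. \<lbrakk>cmod s' \<le> cmod s; Re (x\<^sup>2) \<ge> 1; cmod (x\<^sup>2) \<le> 1 * Re (x\<^sup>2); r \<ge> 1\<rbrakk> \<Longrightarrow>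
      cmod (Gamma_upper_term r x s') \<le> C * exp (- (r\<^sup>2 * Re (x\<^sup>2)))"
    by (rule Gamma_upper_term_bound[of 1 1 "cmod s"]) auto
  obtain h where h: "summable h"
    "\<And>s' x k. \<lbrakk>cmod s' \<le> cmod s; Re (x\<^sup>2) \<ge> 1; cmod (x\<^sup>2) \<le> 1 * Re (x\<^sup>2)\<rbrakk> \<Longrightarrow>
      cmod (Gamma_upper_term (real (Suc k)) x s') \<le> h k"
    by (rule Gamma_upper_term_summable_bound[of 1 1 "cmod s"]) auto
  have sq: "Re ((1 / complex_of_real y)\<^sup>2) = 1 / y\<^sup>2" "cmod ((1 / complex_of_real y)\<^sup>2) = 1 / y\<^sup>2" for y
    by (simp_all add: power_divide norm_divide norm_power flip: of_real_power)
  have ev: "\<forall>\<^sub>F y in at_right 0. 1 / y\<^sup>2 \<ge> (1::real)" by real_asymp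
  have "((\<lambda>y. \<Sum>k. Gamma_upper_term (real (Suc k)) (1 / of_real y) s) \<longlongrightarrow> (\<Sum>k. 0)) (at_right 0)"
  proof (rule tendsto_suminf_dominated[OF _ h(1)])
    show "\<forall>\<^sub>F y in at_right 0. \<forall>k. cmod (Gamma_upper_term (real (Suc k)) (1 / of_real y) s) \<le> h k"
      using ev by eventually_elim (intro allI h(2), simp_all add: sq)
    fix k
    define r where "r = real (Suc k)"
    have r: "r \<ge> 1" by (simp add: r_def)
    have "\<forall>\<^sub>F y in at_right 0. cmod (Gamma_upper_term r (1 / of_real y) s) \<le> C * exp (- (r\<^sup>2 * (1 / y\<^sup>2)))"
      using ev
    proof eventually_elim
      case (elim y)
      then show ?case using C(2)[of s "1 / of_real y" r] r unfolding sq by simp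
    qed
    moreover have "((\<lambda>y. C * exp (- (r\<^sup>2 * (1 / y\<^sup>2)))) \<longlongrightarrow> 0) (at_right 0)" using r by real_asymp
    ultimately show "((\<lambda>y. Gamma_upper_term (real (Suc k)) (1 / of_real y) s) \<longlongrightarrow> 0) (at_right 0)"
      unfolding r_def by (rule Lim_null_comparison)
  qed simp
  then show ?thesis unfolding Gamma_upper_series_def by simp
qed

lemma of_real_powr_tendsto_0:
  assumes "Re z > 0"
  shows "((\<lambda>y. complex_of_real y powr z) \<longlongrightarrow> 0) (at_right 0)"
proof (rule Lim_null_comparison)
  show "\<forall>\<^sub>F y in at_right 0. cmod (complex_of_real y powr z) \<le> y powr Re z"
    using eventually_at_right_less[of "0::real"] by eventually_elim (simp add: norm_powr_real_powr)
  show "((\<lambda>y. y powr Re z) \<longlongrightarrow> 0) (at_right 0)" using assms by real_asymp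
qed

text \<open>Both elementary powers disappear in the limit, \<open>x powr (s - 1)\<close> precisely
  because \<open>Re s > 1\<close>; the second series vanishes as well, so only the Dirichlet series
  is left of a quantity that does not depend on \<open>y\<close>.\<close>

lemma split_xi_dirichlet:
  assumes s: "Re s > 1"
  shows "split_xi 1 s = s * (s - 1) * (Gamma (s / 2) / of_real pi powr (s / 2) * (\<Sum>n. 1 / of_nat (Suc n) powr s))"
proof -
  define L where "L = Gamma (s / 2) / of_real pi powr (s / 2) * (\<Sum>n. 1 / of_nat (Suc n) powr s)"
  have "((\<lambda>y. split_xi (of_real y) s) \<longlongrightarrow> (1 - s) * 0 + s * 0 + s * (s - 1) * (L + 0)) (at_right 0)"
    unfolding split_xi_def L_def using s
    by (intro tendsto_intros of_real_powr_tendsto_0 Gamma_upper_series_tendsto_small Gamma_upper_series_tendsto_large) auto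
  moreover have "((\<lambda>y. split_xi (of_real y) s) \<longlongrightarrow> split_xi 1 s) (at_right 0)"
  proof (rule Lim_transform_eventually[OF tendsto_const])
    show "\<forall>\<^sub>F y in at_right 0. split_xi 1 s = split_xi (of_real y) s"
      using eventually_at_right_less[of "0::real"]
      by eventually_elim (use split_xi_indep sector_of_real in metis)
  qed
  ultimately show ?thesis using tendsto_unique[OF trivial_limit_at_right_real] unfolding L_def by fastforce
qed

lemma rGamma_half_plus1:
  assumes "s \<noteq> 0"
  shows "rGamma (s / 2 + 1 :: complex) = 2 / (s * Gamma (s / 2))"
proof -
  \<comment> \<open>Moving the argument up by 1 absorbs the factor \<open>s\<close>: the reciprocal
    of \<open>s * Gamma (s / 2)\<close> is expressed by an entire function, with no exception at
    \<open>s = 0\<close>.\<close>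
  define R g where "R = rGamma (s / 2 + 1)" and "g = rGamma (s / 2)"
  have "s / 2 * R = g" unfolding R_def g_def by (rule rGamma_plus1)
  then have "R = 2 * g / s" using assms by (auto simp: field_simps)
  then show ?thesis unfolding R_def g_def rGamma_inverse_Gamma[of "s / 2"]
    by (simp only: divide_inverse inverse_mult_distrib mult_ac)
qed

text \<open>The reciprocal Gamma function being entire, \<open>s = 1\<close> is the only singularity
  of the quotient, so it is a witness for the definite description. Uniqueness is the identity
  theorem on the connected punctured plane; the prescribed value 0 settles the remaining
  point.\<close>

lemma zeta_eq_split_xi:
  "zeta = (\<lambda>s. if s = 1 then 0 else split_xi 1 s * of_real pi powr (s / 2) * rGamma (s / 2 + 1) / (2 * (s - 1)))"
proof -
  define Z where "Z = (\<lambda>s. if s = 1 then 0 else split_xi 1 s * of_real pi powr (s / 2) * rGamma (s / 2 + 1) / (2 * (s - 1)))"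
  have "(\<lambda>s. split_xi 1 s * of_real pi powr (s / 2) * rGamma (s / 2 + 1) / (2 * (s - 1))) holomorphic_on - {1}"
    by (intro holomorphic_intros holomorphic_on_subset[OF split_xi_holomorphic]) auto
  then have Z1: "Z holomorphic_on - {1}"
    by (rule holomorphic_transform) (auto simp: Z_def)
  have Z2: "Z s = (\<Sum>n. 1 / of_nat (Suc n) powr s)" if s: "Re s > 1" for s
  proof -
    have "s \<noteq> 1" "s \<noteq> 0" using s by auto
    have np: "s / 2 \<notin> \<int>\<^sub>\<le>\<^sub>0" using s by (auto elim!: nonpos_Ints_cases simp: complex_eq_iff)
    have "Gamma (s / 2) \<noteq> 0" using np by (simp add: Gamma_eq_zero_iff)
    then show ?thesis unfolding Z_def split_xi_dirichlet[OF s] rGamma_half_plus1[OF \<open>s \<noteq> 0\<close>] using \<open>s \<noteq> 1\<close> \<open>s \<noteq> 0\<close>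
      by (simp add: field_simps)
  qed
  have "zeta = Z"
    unfolding zeta_def
  proof (rule the_equality)
    show "Z holomorphic_on - {1} \<and> (\<forall>s. Re s > 1 \<longrightarrow> Z s = (\<Sum>n. 1 / of_nat (Suc n) powr s)) \<and> Z 1 = 0"
      using Z1 Z2 by (simp add: Z_def)
    fix f :: "complex \<Rightarrow> complex"
    assume f: "f holomorphic_on - {1} \<and> (\<forall>s. Re s > 1 \<longrightarrow> f s = (\<Sum>n. 1 / of_nat (Suc n) powr s)) \<and> f 1 = 0"
    have "f w - Z w = 0" if "w \<in> - {1}" for w
    proof (rule analytic_continuation[where f = "\<lambda>w. f w - Z w" and S = "- {1}" and U = "{s. Re s > 1}" and \<xi> = 2])
      show "(\<lambda>w. f w - Z w) holomorphic_on - {1}" using f Z1 by (intro holomorphic_intros) auto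
      show "connected (- {1::complex})" by (rule connected_punctured_universe) simp
      show "(2::complex) islimpt {s. Re s > 1}"
        by (rule interior_limit_point) (simp add: interior_open open_halfspace_Re_gt)
      show "f z - Z z = 0" if "z \<in> {s. Re s > 1}" for z using that f Z2 by simp
    qed (use that in auto)
    then show "f = Z" using f by (intro ext) (auto simp: Z_def)
  qed
  then show ?thesis by (simp add: Z_def)
qed

text \<open>The excluded points are 1 and those where \<open>Gamma (s / 2)\<close> has only its
  default value 0; elsewhere the Gamma factor cancels.\<close>

lemma completed_zeta_eq_split_xi:
  assumes "s \<noteq> 1" "s / 2 \<notin> \<int>\<^sub>\<le>\<^sub>0"
  shows "s * (s - 1) * (zeta s * Gamma (s / 2) / of_real pi powr (s / 2)) = split_xi 1 s"
proof -
  have "s \<noteq> 0" using assms(2) by auto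
  have "Gamma (s / 2) \<noteq> 0" using assms(2) by (simp add: Gamma_eq_zero_iff)
  then show ?thesis unfolding zeta_eq_split_xi rGamma_half_plus1[OF \<open>s \<noteq> 0\<close>] using assms(1) \<open>s \<noteq> 0\<close>
    by (simp add: field_simps)
qed

section \<open>The Upsilon series\<close>

text \<open>A factor on the index can be moved to \<open>x\<close>, because only the product of the
  two enters the lower limit. Sums over multiples of an index thus become the full series at a
  rescaled \<open>x\<close>.\<close>

lemma Gamma_upper_term_scale:
  assumes "c > 0" "r > 0"
  shows "Gamma_upper_term (c * r) x s = of_real c powr (- s) * Gamma_upper_term r (of_real c * x) s"
proof -
  have "complex_of_real ((c * r)\<^sup>2 * pi) powr (s / 2) = of_real c powr s * of_real (r\<^sup>2 * pi) powr (s / 2)"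
    using assms unfolding real_square_pi_powr[OF assms(2)]
    by (subst real_square_pi_powr) (simp_all add: powr_times_real)
  moreover have "complex_of_real ((c * r)\<^sup>2 * pi) * x\<^sup>2 = of_real (r\<^sup>2 * pi) * (of_real c * x)\<^sup>2"
    by (simp add: power_mult_distrib)
  ultimately show ?thesis
    unfolding Gamma_upper_term_def powr_minus by (simp only: divide_inverse inverse_mult_distrib mult_ac)
qed

lemma Gamma_upper_term_scaled_sums:
  assumes "x \<in> sector" "c > 0"
  shows "(\<lambda>k. Gamma_upper_term (c * real (Suc k)) x s) sums (of_real c powr (- s) * Gamma_upper_series (of_real c * x) s)"
  using sums_mult[OF Gamma_upper_term_sums[OF sector_scale[OF assms]], of "of_real c powr (- s)" s] assms
  by (simp add: Gamma_upper_term_scale del: of_nat_Suc)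

text \<open>
  The weight of index \<open>n\<close> in \<open>Upsilon\<close> is \<open>1, -2, 1, 0\<close> for \<open>n\<close> congruent to \<open>1, 2, 3, 0\<close> modulo 4,
  that is, \<open>1 - 3 [2 dvd n] + 2 [4 dvd n]\<close>.
\<close>
lemma Upsilon_summand_sums:
  assumes x: "x \<in> sector"
  shows "Upsilon_summand x s sums (2 powr s * Gamma_upper_series (x / 2) s - 3 * Gamma_upper_series x s
    + 2 * (2 powr (- s) * Gamma_upper_series (2 * x) s))"
proof -
  \<comment> \<open>With index \<open>m / 2\<close>, all \<open>m\<close> give the series at
    \<open>x / 2\<close>, the even \<open>m\<close> that at \<open>x\<close>, and the multiples of 4
    that at \<open>2 * x\<close>.\<close>
  define \<tau> where "\<tau> = (\<lambda>m::nat. Gamma_upper_term (real m / 2) x s)"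
  have group4: "sum f {n * 4..<n * 4 + 4} = f (4 * n) + f (4 * n + 1) + f (4 * n + 2) + f (4 * n + 3)"
    for f :: "nat \<Rightarrow> complex" and n
  proof -
    have "{n * 4..<n * 4 + 4} = {4 * n, 4 * n + 1, 4 * n + 2, 4 * n + 3}" by auto
    then show ?thesis by (simp add: add_ac)
  qed
  have group2: "sum f {n * 2..<n * 2 + 2} = f (2 * n) + f (2 * n + 1)" for f :: "nat \<Rightarrow> complex" and n
  proof -
    have "{n * 2..<n * 2 + 2} = {2 * n, 2 * n + 1}" by auto
    then show ?thesis by simp
  qed
  have "(\<lambda>k. \<tau> (Suc k)) sums (of_real (1/2) powr (- s) * Gamma_upper_series (of_real (1/2) * x) s)"
    using Gamma_upper_term_scaled_sums[OF x, of "1/2" s] by (simp add: \<tau>_def)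
  also have "complex_of_real (1/2) powr (- s) = 2 powr s"
    using Ln_inverse[of 2] by (simp add: powr_def inverse_eq_divide)
  finally have s1: "(\<lambda>k. \<tau> (Suc k)) sums (2 powr s * Gamma_upper_series (x / 2) s)" by simp
  have s2: "(\<lambda>k. \<tau> (2 * Suc k)) sums Gamma_upper_series x s"
  proof -
    have "real (2 * Suc k) / 2 = real (Suc k)" for k by simp
    then show ?thesis unfolding \<tau>_def using Gamma_upper_term_sums[OF x, of s] by (simp only:)
  qed
  have s3: "(\<lambda>k. \<tau> (4 * Suc k)) sums (2 powr (- s) * Gamma_upper_series (2 * x) s)"
  proof -
    have "real (4 * Suc k) / 2 = 2 * real (Suc k)" for k by simp
    then show ?thesis unfolding \<tau>_def
      using Gamma_upper_term_scaled_sums[OF x, of 2 s] by (simp only: of_real_numeral)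
  qed
  \<comment> \<open>Blocks of four align the three convergent series with the summands of
    \<open>Upsilon\<close>: \<open>(1, 1, 1, 1) - 3 * (0, 1, 0, 1) + 2 * (0, 0, 0, 1) = (1, -2, 1,
    0)\<close>.\<close>
  have "(\<lambda>n. (\<tau> (4 * n + 1) + \<tau> (4 * n + 2) + \<tau> (4 * n + 3) + \<tau> (4 * n + 4))
      - 3 * (\<tau> (4 * n + 2) + \<tau> (4 * n + 4)) + 2 * \<tau> (4 * n + 4)) sums
     (2 powr s * Gamma_upper_series (x / 2) s - 3 * Gamma_upper_series x s + 2 * (2 powr (- s) * Gamma_upper_series (2 * x) s))"
  proof (intro sums_add sums_diff sums_mult)
    show "(\<lambda>n. \<tau> (4 * n + 1) + \<tau> (4 * n + 2) + \<tau> (4 * n + 3) + \<tau> (4 * n + 4)) sums (2 powr s * Gamma_upper_series (x / 2) s)"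
    proof -
      have "Suc (4 * n) = 4 * n + 1" "Suc (4 * n + 1) = 4 * n + 2" "Suc (4 * n + 2) = 4 * n + 3" "Suc (4 * n + 3) = 4 * n + 4"
        for n by simp_all
      then show ?thesis using sums_group[OF s1, of 4] unfolding group4 by (simp only: zero_less_numeral simp_thms)
    qed
    show "(\<lambda>n. \<tau> (4 * n + 2) + \<tau> (4 * n + 4)) sums Gamma_upper_series x s"
    proof -
      have "2 * Suc (2 * n) = 4 * n + 2" "2 * Suc (2 * n + 1) = 4 * n + 4" for n by simp_all
      then show ?thesis using sums_group[OF s2, of 2] unfolding group2 by (simp only: zero_less_numeral simp_thms)
    qed
    show "(\<lambda>n. \<tau> (4 * n + 4)) sums (2 powr (- s) * Gamma_upper_series (2 * x) s)"
      using s3 by (simp only: mult_Suc_right add.commute)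
  qed
  moreover have "Upsilon_summand x s = (\<lambda>n. (\<tau> (4 * n + 1) + \<tau> (4 * n + 2) + \<tau> (4 * n + 3) + \<tau> (4 * n + 4))
      - 3 * (\<tau> (4 * n + 2) + \<tau> (4 * n + 4)) + 2 * \<tau> (4 * n + 4))"
  proof
    fix n
    have "complex_of_real ((real m / 2)\<^sup>2 * pi) = of_nat m ^ 2 * of_real pi / 4" for m
      by (simp add: power_divide)
    then have "\<tau> m = Gamma_upper (s / 2) (of_nat m ^ 2 * of_real pi / 4 * x ^ 2) / (of_nat m ^ 2 * of_real pi / 4) powr (s / 2)" for m
      unfolding \<tau>_def Gamma_upper_term_def by (simp only:)
    then have "Upsilon_summand x s n = \<tau> (4 * n + 1) - 2 * \<tau> (4 * n + 2) + \<tau> (4 * n + 3)"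
      unfolding Upsilon_summand_def Let_def by (simp only:)
    then show "Upsilon_summand x s n = (\<tau> (4 * n + 1) + \<tau> (4 * n + 2) + \<tau> (4 * n + 3) + \<tau> (4 * n + 4))
      - 3 * (\<tau> (4 * n + 2) + \<tau> (4 * n + 4)) + 2 * \<tau> (4 * n + 4)"
      by (simp only:) (simp add: algebra_simps)
  qed
  ultimately show ?thesis by (simp only:)
qed

text \<open>Under \<open>x\<close> to \<open>1 / x\<close> and \<open>s\<close> to
  \<open>1 - s\<close> the weights at \<open>x / 2\<close> and \<open>2 * x\<close> are exchanged,
  so the pair is a combination of \<open>B\<close> at three points. With \<open>E * e = 1\<close>,
  the elementary terms carry the factor \<open>E * e - 1 = 0\<close>, and
  \<open>E - 3 + 2 * e\<close> factors as \<open>(E - 1) * (1 - 2 * e)\<close>. The factor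
  \<open>s * (s - 1)\<close> stays because \<open>split_xi\<close> yields \<open>B\<close> only
  after multiplication by it.\<close>

lemma Upsilon_pair_eq:
  assumes x: "x \<in> sector"
  shows "s * (s - 1) * (Upsilon x s + Upsilon (1 / x) (1 - s)) = (2 powr s - 1) * (1 - 2 powr (1 - s)) * split_xi 1 s"
proof -
  have half: "x / 2 \<in> sector" and double: "2 * x \<in> sector"
    using sector_scale[OF x, of "1/2"] sector_scale[OF x, of 2] by auto
  define B where "B = (\<lambda>y. Gamma_upper_series y s + Gamma_upper_series (1 / y) (1 - s))"
  have B: "s * (s - 1) * B y = split_xi 1 s - (1 - s) * y powr s - s * y powr (s - 1)" if "y \<in> sector" for y
    using split_xi_indep[OF that, of s] unfolding split_xi_def[of y] B_def by (simp add: algebra_simps)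
  have t1: "(2::complex) powr (1 - s) = 2 * 2 powr (- s)"
    using powr_add[of "2::complex" 1 "- s"] by simp
  have t2: "2 * (2::complex) powr (- (1 - s)) = 2 powr s"
    using powr_add[of "2::complex" 1 "- (1 - s)"] by simp
  have t3: "(2::complex) powr s * 2 powr (- s) = 1" by (simp add: powr_minus)
  have u1: "Upsilon x s = 2 powr s * Gamma_upper_series (x / 2) s - 3 * Gamma_upper_series x s + 2 powr (1 - s) * Gamma_upper_series (2 * x) s"
    unfolding Upsilon_def sums_unique[OF Upsilon_summand_sums[OF x, of s], symmetric] t1 by simp
  have "Upsilon (1 / x) (1 - s) = 2 powr (1 - s) * Gamma_upper_series (1 / x / 2) (1 - s) - 3 * Gamma_upper_series (1 / x) (1 - s)
      + 2 * (2 powr (- (1 - s)) * Gamma_upper_series (2 * (1 / x)) (1 - s))"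
    unfolding Upsilon_def using sums_unique[OF Upsilon_summand_sums[OF sector_inverse[OF x], of "1 - s"]] by simp
  then have u2: "Upsilon (1 / x) (1 - s) = 2 powr (1 - s) * Gamma_upper_series (1 / (2 * x)) (1 - s) - 3 * Gamma_upper_series (1 / x) (1 - s)
      + 2 powr s * Gamma_upper_series (1 / (x / 2)) (1 - s)"
    unfolding mult.assoc[symmetric] t2 by (simp add: mult.commute)
  have sum: "Upsilon x s + Upsilon (1 / x) (1 - s) = 2 powr s * B (x / 2) - 3 * B x + 2 powr (1 - s) * B (2 * x)"
    unfolding u1 u2 B_def by (simp add: algebra_simps)
  have h1: "(x / 2) powr s = 2 powr (- s) * x powr s" "(x / 2) powr (s - 1) = 2 * 2 powr (- s) * x powr (s - 1)"
  proof -
    have "(x / 2) powr a = 2 powr (- a) * x powr a" for a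
    proof -
      have "x powr a = (2 * (x / 2)) powr a" by simp
      also have "\<dots> = 2 powr a * (x / 2) powr a" by (rule powr_times_real_left) auto
      finally show ?thesis by (simp add: powr_minus)
    qed
    then show "(x / 2) powr s = 2 powr (- s) * x powr s" "(x / 2) powr (s - 1) = 2 * 2 powr (- s) * x powr (s - 1)"
      using t1 by (simp_all add: algebra_simps)
  qed
  have h2: "(2 * x) powr s = 2 powr s * x powr s" by (rule powr_times_real_left) auto
  have h3: "2 * (2 * x) powr (s - 1) = 2 powr s * x powr (s - 1)"
    using t2 by (subst powr_times_real_left) (auto simp: mult.assoc[symmetric])
  define E e where "E = (2::complex) powr s" and "e = (2::complex) powr (- s)"
  have Ee: "E * e = 1" using t3 by (simp add: E_def e_def)
  have "s * (s - 1) * (Upsilon x s + Upsilon (1 / x) (1 - s)) =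
     E * (s * (s - 1) * B (x / 2)) - 3 * (s * (s - 1) * B x) + 2 * e * (s * (s - 1) * B (2 * x))"
    unfolding sum E_def e_def t1 by (simp add: algebra_simps)
  also have "s * (s - 1) * B (x / 2) = split_xi 1 s - (1 - s) * (e * x powr s) - s * (2 * e * x powr (s - 1))"
    using B[OF half] h1 by (simp add: e_def)
  also have "s * (s - 1) * B (2 * x) = split_xi 1 s - (1 - s) * (E * x powr s) - s * (2 * x) powr (s - 1)"
    using B[OF double] h2 by (simp add: E_def)
  also have "(2 * x) powr (s - 1) = E * x powr (s - 1) / 2" using h3 by (simp add: E_def field_simps)
  also have "E * (split_xi 1 s - (1 - s) * (e * x powr s) - s * (2 * e * x powr (s - 1))) - 3 * (s * (s - 1) * B x)
      + 2 * e * (split_xi 1 s - (1 - s) * (E * x powr s) - s * (E * x powr (s - 1) / 2)) =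
      (E - 3 + 2 * e) * split_xi 1 s - 3 * (E * e - 1) * ((1 - s) * x powr s + s * x powr (s - 1))"
    unfolding B[OF x] by (simp add: algebra_simps)
  also have "\<dots> = (E - 1) * (1 - 2 * e) * split_xi 1 s"
    using Ee by (simp add: algebra_simps)
  finally show ?thesis unfolding E_def e_def t1 by simp
qed

lemma Upsilon_pair_holomorphic:
  assumes x: "x \<in> sector"
  shows "(\<lambda>s. Upsilon x s + Upsilon (1 / x) (1 - s)) holomorphic_on UNIV"
proof -
  have h: "Upsilon y holomorphic_on UNIV" if y: "y \<in> sector" for y
  proof -
    have half: "y / 2 \<in> sector" and double: "2 * y \<in> sector"
      using sector_scale[OF y, of "1/2"] sector_scale[OF y, of 2] by auto
    have "(\<lambda>s. 2 powr s * Gamma_upper_series (y / 2) s - 3 * Gamma_upper_series y s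
      + 2 * (2 powr (- s) * Gamma_upper_series (2 * y) s)) holomorphic_on UNIV"
      using Gamma_upper_series_holomorphic[OF y] Gamma_upper_series_holomorphic[OF half] Gamma_upper_series_holomorphic[OF double]
      by (intro holomorphic_intros) auto
    then show ?thesis
      using sums_unique[OF Upsilon_summand_sums[OF y]] by (simp add: Upsilon_def[abs_def])
  qed
  have "(\<lambda>s. Upsilon (1 / x) (1 - s)) holomorphic_on UNIV"
    using holomorphic_on_compose[OF _ holomorphic_on_subset[OF h[OF sector_inverse[OF x]]], of "\<lambda>s. 1 - s" UNIV]
    unfolding o_def by (simp add: holomorphic_on_diff)
  then show ?thesis using h[OF x] by (intro holomorphic_intros)
qed

text \<open>Off 0 and 1 the factor \<open>s * (s - 1)\<close> can be cancelled from the preceding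
  identity; the two points are recovered because both sides are entire in \<open>s\<close>.\<close>

lemma Upsilon_pair_indep:
  assumes x: "x \<in> sector"
  shows "Upsilon x s + Upsilon (1 / x) (1 - s) = Upsilon 1 s + Upsilon 1 (1 - s)"
proof -
  have 1: "1 \<in> sector" by (simp add: sector_def)
  define f where "f = (\<lambda>s. (Upsilon x s + Upsilon (1 / x) (1 - s)) - (Upsilon 1 s + Upsilon (1 / 1) (1 - s)))"
  have "f s = 0"
  proof (rule analytic_continuation[where f = f and S = UNIV and U = "- {0, 1}" and \<xi> = 2])
    show "f holomorphic_on UNIV"
      unfolding f_def by (intro holomorphic_on_diff Upsilon_pair_holomorphic x 1)
    have "open (- {0, 1 :: complex})" by (intro open_Compl finite_imp_closed) simp
    then show "(2::complex) islimpt - {0, 1}"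
      by (intro interior_limit_point) (simp add: interior_open)
    show "f z = 0" if "z \<in> - {0, 1}" for z
    proof -
      have "z * (z - 1) * (Upsilon x z + Upsilon (1 / x) (1 - z)) = z * (z - 1) * (Upsilon 1 z + Upsilon (1 / 1) (1 - z))"
        unfolding Upsilon_pair_eq[OF x] Upsilon_pair_eq[OF 1] ..
      moreover have nz: "z * (z - 1) \<noteq> 0" using that by simp
      ultimately show ?thesis unfolding f_def mult_left_cancel[OF nz] by simp
    qed
  qed auto
  then show ?thesis by (simp add: f_def)
qed

section \<open>The given summands expressed through the auxiliary series\<close>

lemma xi_summand_eq_Gamma_upper_term:
  "xi_summand x s k = Gamma_upper_term (real (Suc k)) x s + Gamma_upper_term (real (Suc k)) (1 / x) (1 - s)"
  by (simp add: xi_summand_def Gamma_upper_term_def Let_def power_divide)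

lemma xi_summand_sums:
  assumes x: "x \<in> sector"
  shows "xi_summand x s sums (Gamma_upper_series x s + Gamma_upper_series (1 / x) (1 - s))"
  using sums_add[OF Gamma_upper_term_sums[OF x] Gamma_upper_term_sums[OF sector_inverse[OF x]]]
  by (simp add: xi_summand_eq_Gamma_upper_term[abs_def])

theorem theorem3:
  "(\<exists>F. entire_continuation
          (\<lambda>s. s * (s - 1) * (zeta s * Gamma (s / 2) / of_real pi powr (s / 2))) F \<and>
        (\<forall>s::complex.
           summable (\<lambda>k. Gamma_upper (s / 2) (of_nat (Suc k) ^ 2 * of_real pi)
                           / (of_nat (Suc k) ^ 2 * of_real pi) powr (s / 2)
                         + Gamma_upper ((1 - s) / 2) (of_nat (Suc k) ^ 2 * of_real pi)
                           / (of_nat (Suc k) ^ 2 * of_real pi) powr ((1 - s) / 2)) \<and>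
           F s = 1 - s * (1 - s) *
             (\<Sum>k. Gamma_upper (s / 2) (of_nat (Suc k) ^ 2 * of_real pi)
                    / (of_nat (Suc k) ^ 2 * of_real pi) powr (s / 2)
                  + Gamma_upper ((1 - s) / 2) (of_nat (Suc k) ^ 2 * of_real pi)
                    / (of_nat (Suc k) ^ 2 * of_real pi) powr ((1 - s) / 2))) \<and>
        (\<forall>x s::complex. Re x > \<bar>Im x\<bar> \<longrightarrow>
           summable (\<lambda>k. xi_summand x s k) \<and>
           F s = (1 - s) * x powr s + s * x powr (s - 1)
                 + s * (s - 1) * (\<Sum>k. xi_summand x s k))) \<and>
   (\<exists>G. entire_continuation
          (\<lambda>s. (2 powr s - 1) * (1 - 2 powr (1 - s))
               * (zeta s * Gamma (s / 2) / of_real pi powr (s / 2))) G \<and>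
        (\<forall>x s::complex. Re x > \<bar>Im x\<bar> \<longrightarrow>
           summable (Upsilon_summand x s) \<and> summable (Upsilon_summand (1 / x) (1 - s)) \<and>
           G s = Upsilon x s + Upsilon (1 / x) (1 - s)))"
proof (rule conjI[OF exI[of _ "split_xi 1"] exI[of _ "\<lambda>s. Upsilon 1 s + Upsilon 1 (1 - s)"]]; intro conjI allI impI)
  \<comment> \<open>Both witnesses are the expressions at \<open>x = 1\<close>; independence of
    \<open>x\<close> then yields the formulas on the whole sector.\<close>
  have 1: "1 \<in> sector" by (simp add: sector_def)
  show "entire_continuation (\<lambda>s. s * (s - 1) * (zeta s * Gamma (s / 2) / of_real pi powr (s / 2))) (split_xi 1)"
    unfolding entire_continuation_def using split_xi_holomorphic completed_zeta_eq_split_xi by simp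
  {
    fix s :: complex
    have eq: "(\<lambda>k. Gamma_upper (s / 2) (of_nat (Suc k) ^ 2 * of_real pi)
                           / (of_nat (Suc k) ^ 2 * of_real pi) powr (s / 2)
                         + Gamma_upper ((1 - s) / 2) (of_nat (Suc k) ^ 2 * of_real pi)
                           / (of_nat (Suc k) ^ 2 * of_real pi) powr ((1 - s) / 2)) = xi_summand 1 s"
      by (simp add: xi_summand_def Let_def fun_eq_iff)
    show "summable (\<lambda>k. Gamma_upper (s / 2) (of_nat (Suc k) ^ 2 * of_real pi)
                           / (of_nat (Suc k) ^ 2 * of_real pi) powr (s / 2)
                         + Gamma_upper ((1 - s) / 2) (of_nat (Suc k) ^ 2 * of_real pi)
                           / (of_nat (Suc k) ^ 2 * of_real pi) powr ((1 - s) / 2))"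
      unfolding eq by (rule sums_summable[OF xi_summand_sums[OF 1]])
    show "split_xi 1 s = 1 - s * (1 - s) *
             (\<Sum>k. Gamma_upper (s / 2) (of_nat (Suc k) ^ 2 * of_real pi)
                    / (of_nat (Suc k) ^ 2 * of_real pi) powr (s / 2)
                  + Gamma_upper ((1 - s) / 2) (of_nat (Suc k) ^ 2 * of_real pi)
                    / (of_nat (Suc k) ^ 2 * of_real pi) powr ((1 - s) / 2))"
      unfolding eq sums_unique[OF xi_summand_sums[OF 1], symmetric] split_xi_def
      by (simp add: algebra_simps)
  }
  {
    fix x s :: complex
    assume "Re x > \<bar>Im x\<bar>"
    then have x: "x \<in> sector" by (simp add: sector_def)
    show "summable (\<lambda>k. xi_summand x s k)"
      by (rule sums_summable[OF xi_summand_sums[OF x]])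
    show "split_xi 1 s = (1 - s) * x powr s + s * x powr (s - 1) + s * (s - 1) * (\<Sum>k. xi_summand x s k)"
      unfolding sums_unique[OF xi_summand_sums[OF x], symmetric] split_xi_indep[OF x, symmetric]
      by (simp add: split_xi_def)
    show "summable (Upsilon_summand x s)" "summable (Upsilon_summand (1 / x) (1 - s))"
      by (rule sums_summable[OF Upsilon_summand_sums], intro x sector_inverse)+
    show "Upsilon 1 s + Upsilon 1 (1 - s) = Upsilon x s + Upsilon (1 / x) (1 - s)"
      using Upsilon_pair_indep[OF x] by simp
  }
  show "entire_continuation (\<lambda>s. (2 powr s - 1) * (1 - 2 powr (1 - s))
               * (zeta s * Gamma (s / 2) / of_real pi powr (s / 2))) (\<lambda>s. Upsilon 1 s + Upsilon 1 (1 - s))"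
    unfolding entire_continuation_def
  proof (intro conjI allI impI)
    show "(\<lambda>s. Upsilon 1 s + Upsilon 1 (1 - s)) holomorphic_on UNIV"
      using Upsilon_pair_holomorphic[OF 1] by simp
    fix s :: complex
    assume s: "s \<noteq> 1 \<and> s / 2 \<notin> \<int>\<^sub>\<le>\<^sub>0"
    then have "s \<noteq> 0" by auto
    define X Z where "X = (2 powr s - 1) * (1 - 2 powr (1 - s))"
      and "Z = zeta s * Gamma (s / 2) / of_real pi powr (s / 2)"
    have "s * (s - 1) * (Upsilon 1 s + Upsilon (1 / 1) (1 - s)) = X * (s * (s - 1) * Z)"
      unfolding X_def Z_def Upsilon_pair_eq[OF 1] using completed_zeta_eq_split_xi s by simp
    then have "(s * (s - 1)) * (Upsilon 1 s + Upsilon 1 (1 - s)) = (s * (s - 1)) * (X * Z)"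
      by (simp only: mult_ac div_by_1)
    \<comment> \<open>Cancellation is possible since \<open>s \<noteq> 1\<close>, while
      \<open>s \<noteq> 0\<close> follows from
      \<open>s / 2 \<notin> \<int>\<^sub>\<le>\<^sub>0\<close>.\<close>
    then have "Upsilon 1 s + Upsilon 1 (1 - s) = X * Z"
      using s \<open>s \<noteq> 0\<close> by simp
    then show "Upsilon 1 s + Upsilon 1 (1 - s) =
      (2 powr s - 1) * (1 - 2 powr (1 - s)) * (zeta s * Gamma (s / 2) / of_real pi powr (s / 2))"
      unfolding X_def Z_def .
  qed
qed

end
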